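(* Let $m=1$ and $\Omega=K=[-\tfrac12,\tfrac12]$. Then for all real-valued $\varphi\in L^2(\Omega,\mathbb{R})$, $$\big\|\mathcal{D}(\varphi)|_{\mathbb{R}\setminus K}\big\|\le\big\|\hat p^{\mathrm{leak}}_{\mathfrak f,\mathfrak f/4}\cdot\mathcal{F}(\varphi)\big\|+C_{\mathrm{sym},\mathfrak f/4}\|\varphi\|,$$ where $\hat p^{\mathrm{leak}}_{\mathfrak f,\mathfrak f/4}(\xi)=e_{\mathfrak f/4}(\xi/\mathfrak f^{1/2})$.
   Context: Fourier transform $\mathcal{F}(f)(\xi)=(2\pi)^{-1/2}\int e^{-\mathrm{i}\xi x}f(x)\,\mathrm dx$ (unitary). Fix $\mathfrak f>0$; $\mathcal{D}(h)=\mathcal{F}^{-1}(m_{\mathfrak f}\mathcal{F}(h))$, $m_{\mathfrak f}(\xi)=\exp(-\mathrm{i}\xi^2/(2\mathfrak f))$. $\tilde\theta(y)=\tfrac12-\tfrac{1-\mathrm i}{2}(\mathrm C(-y/\sqrt\pi)+\mathrm i\,\mathrm S(-y/\sqrt\pi))$ with Fresnel integrals $\mathrm C(x)=\int_0^x\cos(\tfrac\pi2t^2)\mathrm dt$, $\mathrm S(x)=\int_0^x\sin(\tfrac\pi2t^2)\mathrm dt$. For $\beta>0$: $e_\beta(x)=(|\tilde\theta(x-\beta^{1/2})|^2+|\tilde\theta(-x-\beta^{1/2})|^2)^{1/2}$; $\tilde\theta_\beta(x)=\tilde\theta(x)-\tilde\theta(x-\beta^{1/2})$; $\operatorname{sym}(p)(x)=2^{-1/2}(|p(x)|^2+|p(-x)|^2)^{1/2}$;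 $C_{\mathrm{sym},\beta}=\max_{x\in\mathbb{R}}\operatorname{sym}(\tilde\theta_\beta)(x)$. $f|_A:=\mathbf 1_Af$; $L^2(\Omega,\mathbb{R})$ = real-valued $L^2$ functions supported in $\Omega$. *)

theory Defs
  imports "HOL-Analysis.Analysis"
begin

definition L2norm :: "(real \<Rightarrow> complex) \<Rightarrow> real" where
  "L2norm h = sqrt (LINT x|lborel. (cmod (h x))\<^sup>2)"

definition is_L2 :: "(real \<Rightarrow> complex) \<Rightarrow> bool" where
  "is_L2 h \<longleftrightarrow> h \<in> borel_measurable lborel \<and> integrable lborel (\<lambda>x. (cmod (h x))\<^sup>2)"

text \<open>Unitary Fourier transform, given by the absolutely convergent integral
  (used only for functions in L1 \<inter> L2, where it agrees with the L2 Fourier transform).\<close>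
definition fourier :: "(real \<Rightarrow> complex) \<Rightarrow> real \<Rightarrow> complex" where
  "fourier h \<xi> = complex_of_real (1 / sqrt (2 * pi)) * (LINT x|lborel. cis (- \<xi> * x) * h x)"

definition fourier_inv_trunc :: "real \<Rightarrow> (real \<Rightarrow> complex) \<Rightarrow> real \<Rightarrow> complex" where
  "fourier_inv_trunc R g x =
     complex_of_real (1 / sqrt (2 * pi)) * (LINT \<xi>:{-R..R}|lborel. cis (\<xi> * x) * g \<xi>)"

definition fourier_inv_L2 :: "(real \<Rightarrow> complex) \<Rightarrow> real \<Rightarrow> complex" where
  "fourier_inv_L2 g = (SOME h. is_L2 h \<and>
     ((\<lambda>R. LINT x|lborel. (cmod (h x - fourier_inv_trunc R g x))\<^sup>2) \<longlongrightarrow> 0) at_top)"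

definition multiplier :: "real \<Rightarrow> real \<Rightarrow> complex" where
  "multiplier ff \<xi> = cis (- \<xi>\<^sup>2 / (2 * ff))"

definition fresnel_D :: "real \<Rightarrow> (real \<Rightarrow> complex) \<Rightarrow> real \<Rightarrow> complex" where
  "fresnel_D ff h = fourier_inv_L2 (\<lambda>\<xi>. multiplier ff \<xi> * fourier h \<xi>)"

text \<open>Fresnel integrals (oriented integrals, so also valid for negative arguments).\<close>
definition FresnelC :: "real \<Rightarrow> real" where
  "FresnelC x = (LBINT t=0..x. cos (pi / 2 * t\<^sup>2))"

definition FresnelS :: "real \<Rightarrow> real" where
  "FresnelS x = (LBINT t=0..x. sin (pi / 2 * t\<^sup>2))"

definition theta_tilde :: "real \<Rightarrow> complex" where
  "theta_tilde y = 1/2 - (1 - \<i>) / 2 *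
     (complex_of_real (FresnelC (- y / sqrt pi)) + \<i> * complex_of_real (FresnelS (- y / sqrt pi)))"

definition e_beta :: "real \<Rightarrow> real \<Rightarrow> real" where
  "e_beta \<beta> x = sqrt ((cmod (theta_tilde (x - sqrt \<beta>)))\<^sup>2 + (cmod (theta_tilde (- x - sqrt \<beta>)))\<^sup>2)"

definition theta_tilde_beta :: "real \<Rightarrow> real \<Rightarrow> complex" where
  "theta_tilde_beta \<beta> x = theta_tilde x - theta_tilde (x - sqrt \<beta>)"

definition sym :: "(real \<Rightarrow> complex) \<Rightarrow> real \<Rightarrow> real" where
  "sym p x = (1 / sqrt 2) * sqrt ((cmod (p x))\<^sup>2 + (cmod (p (- x)))\<^sup>2)"

text \<open>C_sym,beta = max over x of sym(theta_tilde_beta)(x) (the maximum is attained; written as a supremum).\<close>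
definition C_sym :: "real \<Rightarrow> real" where
  "C_sym \<beta> = (SUP x. sym (theta_tilde_beta \<beta>) x)"

definition p_leak :: "real \<Rightarrow> real \<Rightarrow> real \<Rightarrow> real" where
  "p_leak ff \<beta> \<xi> = e_beta \<beta> (\<xi> / sqrt ff)"

end

theory Submission
  imports Defs "HOL-Probability.Characteristic_Functions"
begin

text \<open>
  The propagator is convolution with the chirp \<open>sqrt (f / (2 * pi)) * cis (- pi / 4) * cis (f * z\<^sup>2 / 2)\<close>, and completing the
  square shows that the chirp cut off to \<open>z > s\<close> has Fourier multiplier
  \<open>m \<xi> * theta_tilde (\<xi> / sqrt f - s * sqrt f)\<close>. A point \<open>x > 1/2\<close> sees the support of \<open>\<phi>\<close> only through positive
  arguments \<open>z = x - y\<close>. The part \<open>z > 1/2\<close> is bounded by the multiplier \<open>theta_tilde (\<xi> / sqrt f - sqrt (f/4))\<close>.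
  The part \<open>0 < z \<le> 1/2\<close> has multiplier \<open>theta_tilde_beta\<close> and only involves \<open>y > 0\<close>; since \<open>\<phi>\<close> is real, the
  multiplier can be symmetrised, which gives \<open>C_sym\<close>. Points \<open>x < -1/2\<close> are treated by reflection, and there
  the near part only involves \<open>y < 0\<close>, so the two near parts add up to at most \<open>C_sym\<^sup>2 \<parallel>\<phi>\<parallel>\<^sup>2\<close>.
\<close>

section \<open>Square-integrable functions\<close>

lemma borel_measurable_cis [measurable]: "cis \<in> borel_measurable borel"
  by (intro borel_measurable_continuous_onI continuous_intros)

lemma borel_measurable_cnj [measurable]: "cnj \<in> borel_measurable borel"
  by (intro borel_measurable_continuous_onI continuous_intros)

lemma is_L2_D:
  assumes "is_L2 h"
  shows "h \<in> borel_measurable lborel" "h \<in> borel_measurable borel" "integrable lborel (\<lambda>x. (cmod (h x))\<^sup>2)"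
  using assms by (auto simp: is_L2_def)

lemma cmod_add_sq_le:
  fixes a b :: complex and t :: real
  assumes "t > 0"
  shows "(cmod (a + b))\<^sup>2 \<le> (1 + t) * (cmod a)\<^sup>2 + (1 + 1 / t) * (cmod b)\<^sup>2"
proof -
  have "(cmod (a + b))\<^sup>2 \<le> (cmod a + cmod b)\<^sup>2"
    by (intro power_mono norm_triangle_ineq) auto
  also have "0 \<le> (t * cmod a - cmod b)\<^sup>2 / t"
    using assms by simp
  then have "(cmod a + cmod b)\<^sup>2 \<le> (1 + t) * (cmod a)\<^sup>2 + (1 + 1 / t) * (cmod b)\<^sup>2"
    using assms by (simp add: field_simps power2_eq_square)
  finally show ?thesis .
qed

lemma cmod_add_sq_le_2: "(cmod (a + b))\<^sup>2 \<le> 2 * (cmod a)\<^sup>2 + 2 * (cmod b)\<^sup>2"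
  using cmod_add_sq_le[of 1 a b] by simp

lemma cmod_diff_sq_le_2: "(cmod (a - b))\<^sup>2 \<le> 2 * (cmod a)\<^sup>2 + 2 * (cmod b)\<^sup>2"
  using cmod_add_sq_le_2[of a "- b"] by simp

lemma cmod_mult_le_sq: "cmod (a * b) \<le> (cmod a)\<^sup>2 + (cmod b)\<^sup>2"
proof -
  have "0 \<le> (cmod a - cmod b)\<^sup>2" "0 \<le> cmod a * cmod b" by auto
  then show ?thesis unfolding power2_diff norm_mult by linarith
qed

lemma sqrt_le_add_sqrt:
  fixes X Y Z :: real
  assumes X: "0 \<le> X" and Y: "0 \<le> Y"
    and Z: "\<And>t. t > 0 \<Longrightarrow> Z \<le> (1 + t) * X + (1 + 1 / t) * Y"
  shows "sqrt Z \<le> sqrt X + sqrt Y"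
proof -
  have main: "Z \<le> (sqrt X + sqrt Y)\<^sup>2"
  proof (cases "X = 0 \<or> Y = 0")
    case True
    have "Z \<le> X + Y + e" if e: "e > 0" for e
    proof (cases "X = 0")
      case True
      have "Z \<le> (1 + 1 / ((Y + 1) / e)) * Y" using Z[of "(Y + 1) / e"] True Y e by simp
      also have "\<dots> \<le> Y + e" using Y e by (simp add: field_simps)
      finally show ?thesis using True by simp
    next
      case False
      then have "Y = 0" using \<open>X = 0 \<or> Y = 0\<close> by simp
      have "Z \<le> (1 + e / (X + 1)) * X" using Z[of "e / (X + 1)"] \<open>Y = 0\<close> X e by simp
      also have "\<dots> \<le> X + e" using X e by (simp add: field_simps)
      finally show ?thesis using \<open>Y = 0\<close> by simp
    qed
    then have "Z \<le> X + Y" by (rule field_le_epsilon)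
    then show ?thesis using True X Y by (auto simp: power2_eq_square)
  next
    case False
    define p q where "p = sqrt X" and "q = sqrt Y"
    have pq: "p > 0" "q > 0" "X = p\<^sup>2" "Y = q\<^sup>2" using False X Y by (auto simp: p_def q_def)
    have "Z \<le> (1 + q / p) * p\<^sup>2 + (1 + 1 / (q / p)) * q\<^sup>2"
      using Z[of "q / p"] pq by simp
    also have "\<dots> = (p + q)\<^sup>2"
      using pq by (simp add: field_simps power2_eq_square)
    finally show ?thesis by (simp add: p_def q_def)
  qed
  show ?thesis
    using real_sqrt_le_mono[OF main] X Y by simp
qed

lemma is_L2_bound:
  assumes "h \<in> borel_measurable lborel" "integrable lborel f"
    and "\<And>x. (cmod (h x))\<^sup>2 \<le> f x"
  shows "is_L2 h"
  unfolding is_L2_def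
proof
  show "integrable lborel (\<lambda>x. (cmod (h x))\<^sup>2)"
    by (rule Bochner_Integration.integrable_bound[OF assms(2)])
       (use assms in \<open>auto intro!: AE_I2 intro: order_trans[OF _ abs_ge_self]\<close>)
qed fact

lemma is_L2_diff: "is_L2 f \<Longrightarrow> is_L2 g \<Longrightarrow> is_L2 (\<lambda>x. f x - g x)"
  by (rule is_L2_bound[where f = "\<lambda>x. 2 * (cmod (f x))\<^sup>2 + 2 * (cmod (g x))\<^sup>2"])
     (auto simp: is_L2_def cmod_diff_sq_le_2)

lemma is_L2_mult_bounded:
  assumes "is_L2 f" "b \<in> borel_measurable lborel" "\<And>x. cmod (b x) \<le> M"
  shows "is_L2 (\<lambda>x. b x * f x)"
proof (rule is_L2_bound[where f = "\<lambda>x. M\<^sup>2 * (cmod (f x))\<^sup>2"])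
  have [measurable]: "f \<in> borel_measurable borel" "b \<in> borel_measurable borel"
    using assms by (auto simp: is_L2_def)
  show "(\<lambda>x. b x * f x) \<in> borel_measurable lborel" by simp
  show "integrable lborel (\<lambda>x. M\<^sup>2 * (cmod (f x))\<^sup>2)"
    using assms(1) by (auto simp: is_L2_def)
  show "(cmod (b x * f x))\<^sup>2 \<le> M\<^sup>2 * (cmod (f x))\<^sup>2" for x
    unfolding norm_mult power_mult_distrib
    by (intro mult_right_mono power_mono assms) auto
qed

lemma is_L2_affine:
  assumes "is_L2 f" "c \<noteq> 0"
  shows "is_L2 (\<lambda>x. f (t + c * x))"
proof -
  have [measurable]: "f \<in> borel_measurable borel" using assms by (simp add: is_L2_def)
  show ?thesis
    using lborel_integrable_real_affine[OF is_L2_D(3)[OF assms(1)] assms(2), of t]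
    by (simp add: is_L2_def)
qed

lemma is_L2_integrable_mult:
  assumes "is_L2 f" "is_L2 g"
  shows "integrable lborel (\<lambda>x. f x * g x)"
proof -
  have [measurable]: "f \<in> borel_measurable borel" "g \<in> borel_measurable borel"
    using assms by (auto simp: is_L2_def)
  have "integrable lborel (\<lambda>x. (cmod (f x))\<^sup>2 + (cmod (g x))\<^sup>2)"
    using assms by (auto simp: is_L2_def)
  then show ?thesis
    by (rule Bochner_Integration.integrable_bound) (auto simp: cmod_mult_le_sq)
qed

lemma is_L2_cnj: "is_L2 f \<Longrightarrow> is_L2 (\<lambda>x. cnj (f x))"
  unfolding is_L2_def by (auto intro: measurable_compose[OF _ borel_measurable_cnj])

lemma is_L2_bounded_support:
  assumes "h \<in> borel_measurable lborel" "\<And>x. cmod (h x) \<le> M" "\<And>x. x \<notin> {a..b} \<Longrightarrow> h x = 0"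
  shows "is_L2 h"
proof (rule is_L2_bound[OF assms(1), where f = "\<lambda>x. M\<^sup>2 * indicator {a..b} x"])
  show "integrable lborel (\<lambda>x. M\<^sup>2 * indicat_real {a..b} x)"
    by (auto intro!: integrable_mult_right integrable_real_indicator emeasure_lborel_cbox_finite simp: emeasure_lborel_Icc_eq)
  show "(cmod (h x))\<^sup>2 \<le> M\<^sup>2 * indicat_real {a..b} x" for x
    using assms(2)[of x] assms(3)[of x] by (auto intro: power_mono split: split_indicator)
qed

lemma integrable_bounded_support:
  fixes h :: "real \<Rightarrow> complex"
  assumes "h \<in> borel_measurable lborel" "\<And>x. cmod (h x) \<le> M" "\<And>x. x \<notin> {a..b} \<Longrightarrow> h x = 0"
  shows "integrable lborel h"
proof (rule Bochner_Integration.integrable_bound[OF _ assms(1)])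
  show "integrable lborel (\<lambda>x. M * indicat_real {a..b} x)"
    by (auto intro!: integrable_mult_right integrable_real_indicator simp: emeasure_lborel_Icc_eq)
  show "AE x in lborel. cmod (h x) \<le> norm (M * indicat_real {a..b} x)"
    using assms(2,3) by (auto intro!: AE_I2 order_trans[OF assms(2)] split: split_indicator)
qed

lemma is_L2_imp_integrable_bounded_support:
  assumes "is_L2 h" "\<And>x. x \<notin> {a..b} \<Longrightarrow> h x = 0"
  shows "integrable lborel h"
proof (rule Bochner_Integration.integrable_bound)
  show "integrable lborel (\<lambda>x. (cmod (h x))\<^sup>2 + indicat_real {a..b} x)"
    using assms(1) by (auto intro!: integrable_mult_right integrable_real_indicator simp: emeasure_lborel_Icc_eq is_L2_def)
  show "AE x in lborel. cmod (h x) \<le> norm ((cmod (h x))\<^sup>2 + indicat_real {a..b} x)"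
  proof (rule AE_I2)
    fix x
    have "cmod (h x) \<le> (cmod (h x))\<^sup>2 + 1"
      using zero_le_power2[of "cmod (h x) - 1"] norm_ge_zero[of "h x"]
      unfolding power2_diff by (simp only: one_power2 mult_1_right)
    then show "cmod (h x) \<le> norm ((cmod (h x))\<^sup>2 + indicat_real {a..b} x)"
      using assms(2)[of x] by (auto split: split_indicator)
  qed
qed (use assms in \<open>auto simp: is_L2_def\<close>)

lemma L2_Fatou:
  fixes u :: "nat \<Rightarrow> real \<Rightarrow> complex"
  assumes u: "\<And>n. is_L2 (u n)" and lim: "\<And>x. (\<lambda>n. u n x) \<longlonglongrightarrow> h x"
    and L: "(\<lambda>n. LINT x|lborel. (cmod (u n x))\<^sup>2) \<longlonglongrightarrow> L"
  shows "is_L2 h" "(LINT x|lborel. (cmod (h x))\<^sup>2) \<le> L"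
proof -
  have [measurable]: "u n \<in> borel_measurable borel" for n using u by (auto simp: is_L2_def)
  have h[measurable]: "h \<in> borel_measurable borel"
    by (rule borel_measurable_LIMSEQ_metric[OF _ lim]) auto
  have L0: "L \<ge> 0"
    by (rule LIMSEQ_le_const[OF L]) auto
  have eq: "(\<integral>\<^sup>+ x. ennreal ((cmod (u n x))\<^sup>2) \<partial>lborel) = ennreal (LINT x|lborel. (cmod (u n x))\<^sup>2)" for n
    using u[of n] by (intro nn_integral_eq_integral) (auto simp: is_L2_def)
  have "(\<integral>\<^sup>+ x. ennreal ((cmod (h x))\<^sup>2) \<partial>lborel)
      = (\<integral>\<^sup>+ x. liminf (\<lambda>n. ennreal ((cmod (u n x))\<^sup>2)) \<partial>lborel)"
  proof (rule nn_integral_cong)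
    fix x
    have "(\<lambda>n. ennreal ((cmod (u n x))\<^sup>2)) \<longlonglongrightarrow> ennreal ((cmod (h x))\<^sup>2)"
      by (intro tendsto_ennrealI tendsto_intros lim)
    from lim_imp_Liminf[OF _ this] show "ennreal ((cmod (h x))\<^sup>2) = liminf (\<lambda>n. ennreal ((cmod (u n x))\<^sup>2))"
      by simp
  qed
  also have "\<dots> \<le> liminf (\<lambda>n. \<integral>\<^sup>+ x. ennreal ((cmod (u n x))\<^sup>2) \<partial>lborel)"
    by (rule nn_integral_liminf) auto
  also have "\<dots> = ennreal L"
    unfolding eq by (intro lim_imp_Liminf tendsto_ennrealI L) auto
  finally have le: "(\<integral>\<^sup>+ x. ennreal ((cmod (h x))\<^sup>2) \<partial>lborel) \<le> ennreal L" .
  have int: "integrable lborel (\<lambda>x. (cmod (h x))\<^sup>2)"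
    by (rule integrableI_nonneg) (use le in \<open>auto simp: less_top[symmetric] top_unique intro: le_less_trans\<close>)
  then show "is_L2 h" by (simp add: is_L2_def)
  show "(LINT x|lborel. (cmod (h x))\<^sup>2) \<le> L"
    using le L0 by (subst (asm) nn_integral_eq_integral[OF int]) auto
qed

lemma integrable_tensor_product:
  fixes f g :: "real \<Rightarrow> complex"
  assumes "integrable lborel f" "integrable lborel g"
  shows "integrable (lborel \<Otimes>\<^sub>M lborel) (\<lambda>(x, y). f x * g y)"
proof -
  have [measurable]: "f \<in> borel_measurable borel" "g \<in> borel_measurable borel"
    using assms by (auto dest: borel_measurable_integrable)
  show ?thesis
  proof (rule lborel_pair.Fubini_integrable)
    show "integrable lborel (\<lambda>x. \<integral>y. norm (case (x, y) of (x, y) \<Rightarrow> f x * g y) \<partial>lborel)"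
      using assms by (simp add: norm_mult)
  qed (use assms in auto)
qed

lemma fourier_exchange:
  assumes f: "integrable lborel f" and g: "integrable lborel g"
  shows "(LINT x|lborel. fourier f x * g x) = (LINT x|lborel. f x * fourier g x)"
proof -
  have fm[measurable]: "f \<in> borel_measurable borel" and gm[measurable]: "g \<in> borel_measurable borel"
    using assms by (auto dest: borel_measurable_integrable)
  have "integrable (lborel \<Otimes>\<^sub>M lborel) (\<lambda>(x, y). cis (- x * y) * (f x * g y))"
    by (rule Bochner_Integration.integrable_bound[OF integrable_tensor_product[OF f g]])
       (auto simp: norm_mult split_beta')
  from lborel_pair.Fubini_integral[OF this]
  have "(LINT y|lborel. LINT x|lborel. cis (- x * y) * (f x * g y)) =
    (LINT x|lborel. LINT y|lborel. cis (- x * y) * (f x * g y))" .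
  moreover have "(LINT x|lborel. cis (- x * y) * (f x * g y)) = (LINT x|lborel. cis (- y * x) * f x) * g y" for y
    by (simp add: mult.assoc[symmetric] mult.commute[of y])
  moreover have "(LINT y|lborel. cis (- x * y) * (f x * g y)) = f x * (LINT y|lborel. cis (- x * y) * g y)" for x
    by (simp add: integral_mult_right_zero[symmetric] del: integral_mult_right_zero) (simp add: mult_ac)
  ultimately show ?thesis
    unfolding fourier_def by (simp add: mult.assoc mult.left_commute)
qed

definition convol :: "(real \<Rightarrow> complex) \<Rightarrow> (real \<Rightarrow> complex) \<Rightarrow> real \<Rightarrow> complex" where
  "convol f g x = (LINT y|lborel. f (x - y) * g y)"

lemma
  assumes f: "integrable lborel f" and g: "integrable lborel g"
  shows integrable_convol: "integrable lborel (convol f g)"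
    and fourier_convol: "fourier (convol f g) \<xi> = sqrt (2 * pi) * fourier f \<xi> * fourier g \<xi>"
proof -
  have fm[measurable]: "f \<in> borel_measurable borel" and gm[measurable]: "g \<in> borel_measurable borel"
    using assms by (auto dest: borel_measurable_integrable)
  have shift: "integrable lborel (\<lambda>x. f (x - y))" "(LINT x|lborel. cmod (f (x - y))) = (LINT x|lborel. cmod (f x))" for y
    using lborel_integrable_real_affine[OF f, of 1 "-y"]
      lborel_integral_real_affine[of 1 "\<lambda>x. cmod (f x)" "-y"] by auto
  have "integrable (lborel \<Otimes>\<^sub>M lborel) (\<lambda>(y, x). f (x - y) * g y)"
  proof (rule lborel_pair.Fubini_integrable)
    show "AE x in lborel. integrable lborel (\<lambda>y. case (x, y) of (y, x) \<Rightarrow> f (x - y) * g y)"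
      using shift by auto
    show "integrable lborel (\<lambda>x. LINT y|lborel. cmod (case (x, y) of (y, x) \<Rightarrow> f (x - y) * g y))"
      using shift g by (simp add: norm_mult)
  qed measurable
  then have int: "integrable (lborel \<Otimes>\<^sub>M lborel) (\<lambda>(x, y). f (x - y) * g y)"
    by (subst lborel_pair.integrable_product_swap_iff[symmetric]) (simp add: split_beta')
  show "integrable lborel (convol f g)"
    using lborel_pair.integrable_fst'[OF int] by (simp add: convol_def[abs_def])
  have int2: "integrable (lborel \<Otimes>\<^sub>M lborel) (\<lambda>(x, y). cis (- \<xi> * x) * (f (x - y) * g y))"
    by (rule Bochner_Integration.integrable_bound[OF int])
       (auto simp: norm_mult split_beta')
  have inner: "(LINT x|lborel. cis (- \<xi> * x) * (f (x - y) * g y)) =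
    (LINT x|lborel. cis (- \<xi> * x) * f x) * (cis (- \<xi> * y) * g y)" for y
  proof -
    have "(LINT x|lborel. cis (- \<xi> * x) * (f (x - y) * g y)) = (LINT x|lborel. cis (- \<xi> * x) * f (x - y)) * g y"
      by (simp add: mult.assoc[symmetric])
    also have "(LINT x|lborel. cis (- \<xi> * x) * f (x - y)) = (LINT x|lborel. cis (- \<xi> * (y + 1 * x)) * f ((y + 1 * x) - y))"
      by (subst lborel_integral_real_affine[of 1 _ y]) auto
    also have "\<dots> = (LINT x|lborel. cis (- \<xi> * x) * f x) * cis (- \<xi> * y)"
      by (simp add: cis_mult[symmetric] algebra_simps del: integral_mult_right_zero integral_mult_left_zero flip: integral_mult_right_zero integral_mult_left_zero)
         (simp add: cis_mult algebra_simps)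
    finally show ?thesis by (simp add: mult_ac)
  qed
  have "(LINT x|lborel. cis (- \<xi> * x) * convol f g x) = (LINT x|lborel. LINT y|lborel. cis (- \<xi> * x) * (f (x - y) * g y))"
    by (simp add: convol_def)
  also have "\<dots> = (LINT y|lborel. LINT x|lborel. cis (- \<xi> * x) * (f (x - y) * g y))"
    by (rule lborel_pair.Fubini_integral[symmetric, OF int2])
  also have "\<dots> = (LINT x|lborel. cis (- \<xi> * x) * f x) * (LINT y|lborel. cis (- \<xi> * y) * g y)"
    unfolding inner by simp
  finally have *: "(LINT x|lborel. cis (- \<xi> * x) * convol f g x) =
    (LINT x|lborel. cis (- \<xi> * x) * f x) * (LINT y|lborel. cis (- \<xi> * y) * g y)" .
  have s: "complex_of_real (sqrt (2 * pi)) * complex_of_real (1 / sqrt (2 * pi)) = 1"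
    by (simp add: of_real_mult[symmetric] del: of_real_mult)
  show "fourier (convol f g) \<xi> = sqrt (2 * pi) * fourier f \<xi> * fourier g \<xi>"
    unfolding fourier_def * using s by (simp add: mult_ac)
qed

section \<open>Plancherel theorem\<close>

lemma L2_approx_bounded:
  assumes h: "is_L2 h" and e: "e > 0"
  shows "\<exists>m::nat. m > 0 \<and>
    (LINT x|lborel. (cmod (h x - (if \<bar>x\<bar> \<le> m \<and> cmod (h x) \<le> m then h x else 0)))\<^sup>2) < e"
proof -
  let ?k = "\<lambda>(m::nat) x. if \<bar>x\<bar> \<le> m \<and> cmod (h x) \<le> m then h x else 0"
  have [measurable]: "h \<in> borel_measurable borel" using h by (simp add: is_L2_def)
  have "(\<lambda>m. LINT x|lborel. (cmod (h x - ?k m x))\<^sup>2) \<longlonglongrightarrow> (LINT (x::real)|lborel. 0)"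
  proof (rule integral_dominated_convergence[where w = "\<lambda>x. (cmod (h x))\<^sup>2"])
    show "AE x in lborel. (\<lambda>m. (cmod (h x - ?k m x))\<^sup>2) \<longlonglongrightarrow> 0"
    proof (rule AE_I2)
      fix x
      obtain n :: nat where n: "max \<bar>x\<bar> (cmod (h x)) \<le> n" using real_arch_simple by blast
      have "eventually (\<lambda>m. (cmod (h x - ?k m x))\<^sup>2 = 0) sequentially"
        using eventually_ge_at_top[of n] by eventually_elim (use n in auto)
      then show "(\<lambda>m. (cmod (h x - ?k m x))\<^sup>2) \<longlonglongrightarrow> 0" by (rule tendsto_eventually)
    qed
  qed (use h in \<open>auto simp: is_L2_def\<close>)
  then have "eventually (\<lambda>m. (LINT x|lborel. (cmod (h x - ?k m x))\<^sup>2) < e) sequentially"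
    using e by (intro order_tendstoD) auto
  then have "eventually (\<lambda>m. m > 0 \<and> (LINT x|lborel. (cmod (h x - ?k m x))\<^sup>2) < e) sequentially"
    by (intro eventually_conj eventually_gt_at_top)
  then show ?thesis using eventually_happens'[OF sequentially_bot] by fastforce
qed

lemma L2_dense_continuous:
  assumes h: "is_L2 h" and e: "e > 0"
  obtains g M a where "continuous_on UNIV g" "\<And>x. cmod (g x) \<le> M" "\<And>x. x \<notin> {-a..a} \<Longrightarrow> g x = 0"
    "(LINT x|lborel. (cmod (h x - g x))\<^sup>2) < e"
proof -
  have hm[measurable]: "h \<in> borel_measurable borel" using h by (simp add: is_L2_def)
  obtain m :: nat where m: "m > 0"
    "(LINT x|lborel. (cmod (h x - (if \<bar>x\<bar> \<le> m \<and> cmod (h x) \<le> m then h x else 0)))\<^sup>2) < e / 4"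
    using L2_approx_bounded[OF h, of "e / 4"] e by auto
  define k where "k = (\<lambda>x::real. if \<bar>x\<bar> \<le> m \<and> cmod (h x) \<le> m then h x else 0)"
  have km[measurable]: "k \<in> borel_measurable borel" unfolding k_def by measurable
  have kb: "cmod (k x) \<le> m" for x by (auto simp: k_def)
  have "k \<in> borel_measurable lebesgue" using km by (simp add: measurable_completion)
  then have "k measurable_on UNIV" by (rule lebesgue_measurable_imp_measurable_on) simp
  then obtain N g0 where N: "negligible N" and g0: "\<And>n. continuous_on UNIV (g0 n)"
    and g0_lim: "\<And>x. x \<notin> N \<Longrightarrow> (\<lambda>n. g0 n x) \<longlonglongrightarrow> k x"
    by (auto simp: measurable_on_def)
  define cl where "cl = (\<lambda>w::complex. (m / max (real m) (cmod w)) *\<^sub>R w)"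
  define cut where "cut = (\<lambda>x::real. max 0 (min 1 (m + 1 - \<bar>x\<bar>)))"
  define g where "g = (\<lambda>n x. cut x *\<^sub>R cl (g0 n x))"
  have cl_cont: "isCont cl w" for w
    unfolding cl_def using m(1) by (intro continuous_intros) auto
  have clb: "cmod (cl w) \<le> m" for w
    using m(1) by (cases "cmod w \<le> m") (auto simp: cl_def max_def)
  have clk: "cl (k x) = k x" for x
    using kb[of x] m(1) by (simp add: cl_def)
  have chi: "0 \<le> cut x" "cut x \<le> 1" for x by (auto simp: cut_def)
  have gc: "continuous_on UNIV (g n)" for n
    unfolding g_def cut_def
    by (intro continuous_intros continuous_on_compose2[OF continuous_at_imp_continuous_on[of UNIV cl]] g0 ballI cl_cont) auto
  have gb: "cmod (g n x) \<le> m" for n x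
    using mult_mono[OF chi(2)[of x] clb[of "g0 n x"]] chi[of x] by (simp add: g_def)
  have gs: "g n x = 0" if "x \<notin> {-(real m + 1)..real m + 1}" for n x
    using that by (auto simp: g_def cut_def)
  have [measurable]: "g n \<in> borel_measurable borel" for n
    by (rule borel_measurable_continuous_onI[OF gc])
  have AE_N: "AE x in lborel. x \<notin> N"
    using AE_not_in[OF N[unfolded negligible_iff_null_sets]] by (simp add: AE_completion_iff)
  have "(\<lambda>n. LINT x|lborel. (cmod (k x - g n x))\<^sup>2) \<longlonglongrightarrow> (LINT (x::real)|lborel. 0)"
  proof (rule integral_dominated_convergence[where w = "\<lambda>x. (2 * real m)\<^sup>2 * indicator {-(real m + 1)..real m + 1} x"])
    show "integrable lborel (\<lambda>x. (2 * real m)\<^sup>2 * indicat_real {-(real m + 1)..real m + 1} x)"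
      by (auto intro!: integrable_mult_right integrable_real_indicator simp: emeasure_lborel_Icc_eq)
    show "AE x in lborel. (\<lambda>n. (cmod (k x - g n x))\<^sup>2) \<longlonglongrightarrow> 0"
      using AE_N
    proof eventually_elim
      case (elim x)
      have "(\<lambda>n. cut x *\<^sub>R cl (g0 n x)) \<longlonglongrightarrow> cut x *\<^sub>R cl (k x)"
        by (intro tendsto_intros isCont_tendsto_compose[OF cl_cont] g0_lim elim)
      also have "cut x *\<^sub>R cl (k x) = k x"
        unfolding clk by (auto simp: k_def cut_def)
      finally have "(\<lambda>n. g n x) \<longlonglongrightarrow> k x" by (simp add: g_def)
      then have "(\<lambda>n. (cmod (k x - g n x))\<^sup>2) \<longlonglongrightarrow> (cmod (k x - k x))\<^sup>2" by (intro tendsto_intros)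
      then show ?case by simp
    qed
    show "AE x in lborel. norm ((cmod (k x - g n x))\<^sup>2) \<le> (2 * real m)\<^sup>2 * indicator {-(real m + 1)..real m + 1} x" for n
    proof (rule AE_I2)
      fix x
      have "cmod (k x - g n x) \<le> 2 * m"
        using norm_triangle_ineq4[of "k x" "g n x"] kb[of x] gb[of n x] by simp
      then have "(cmod (k x - g n x))\<^sup>2 \<le> (2 * real m)\<^sup>2" by (intro power_mono) auto
      moreover have "k x = 0" if "x \<notin> {-(real m + 1)..real m + 1}"
        using that by (auto simp: k_def)
      ultimately show "norm ((cmod (k x - g n x))\<^sup>2) \<le> (2 * real m)\<^sup>2 * indicator {-(real m + 1)..real m + 1} x"
        using gs[of x n] by (auto split: split_indicator)
    qed
  qed auto
  then have "eventually (\<lambda>n. (LINT x|lborel. (cmod (k x - g n x))\<^sup>2) < e / 4) sequentially"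
    using e by (intro order_tendstoD) auto
  then obtain n where n: "(LINT x|lborel. (cmod (k x - g n x))\<^sup>2) < e / 4"
    by (auto simp: eventually_sequentially)
  have k2: "is_L2 k"
    by (rule is_L2_bounded_support[where M = m and a = "- real m" and b = m]) (auto simp: kb k_def)
  have g2: "is_L2 (g n)"
    by (rule is_L2_bounded_support[OF _ gb gs]) auto
  have "(LINT x|lborel. (cmod (h x - g n x))\<^sup>2)
      \<le> (LINT x|lborel. 2 * (cmod (h x - k x))\<^sup>2 + 2 * (cmod (k x - g n x))\<^sup>2)"
  proof (rule integral_mono)
    show "(cmod (h x - g n x))\<^sup>2 \<le> 2 * (cmod (h x - k x))\<^sup>2 + 2 * (cmod (k x - g n x))\<^sup>2" for x
      using cmod_add_sq_le_2[of "h x - k x" "k x - g n x"] by simp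
  qed (use is_L2_diff[OF h g2] is_L2_diff[OF h k2] is_L2_diff[OF k2 g2] in \<open>auto simp: is_L2_def\<close>)
  also have "\<dots> = 2 * (LINT x|lborel. (cmod (h x - k x))\<^sup>2) + 2 * (LINT x|lborel. (cmod (k x - g n x))\<^sup>2)"
    using is_L2_diff[OF h k2] is_L2_diff[OF k2 g2] by (simp add: is_L2_def)
  also have "\<dots> < e" using n m(2) unfolding k_def by simp
  finally show ?thesis 
    by (intro that[of "g n" m "real m + 1"] gc gb gs)
qed

lemma L2_translation_continuous_bump:
  fixes g :: "real \<Rightarrow> complex"
  assumes g: "continuous_on UNIV g" and gb: "\<And>x. cmod (g x) \<le> M" and gs: "\<And>x. x \<notin> {-a..a} \<Longrightarrow> g x = 0"
    and z: "z \<longlonglongrightarrow> 0"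
  shows "(\<lambda>n. LINT x|lborel. (cmod (g (x + z n) - g x))\<^sup>2) \<longlonglongrightarrow> 0"
proof -
  have [measurable]: "g \<in> borel_measurable borel"
    by (rule borel_measurable_continuous_onI[OF g])
  obtain B where B: "\<And>n. \<bar>z n\<bar> \<le> B"
    using Bseq_def[of z] convergent_imp_Bseq[of z] z by (auto simp: convergent_def)
  have "(\<lambda>n. LINT x|lborel. (cmod (g (x + z n) - g x))\<^sup>2) \<longlonglongrightarrow> (LINT (x::real)|lborel. 0)"
  proof (rule integral_dominated_convergence[where w = "\<lambda>x. (2 * M)\<^sup>2 * indicator {-(a + B)..a + B} x"])
    show "integrable lborel (\<lambda>x. (2 * M)\<^sup>2 * indicat_real {-(a + B)..a + B} x)"
      by (auto intro!: integrable_mult_right integrable_real_indicator simp: emeasure_lborel_Icc_eq)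
    show "AE x in lborel. (\<lambda>n. (cmod (g (x + z n) - g x))\<^sup>2) \<longlonglongrightarrow> 0"
    proof (rule AE_I2)
      fix x
      have "isCont g x" using g by (simp add: continuous_on_eq_continuous_at)
      moreover have "(\<lambda>n. x + z n) \<longlonglongrightarrow> x" using tendsto_add[OF tendsto_const z, of x] by simp
      ultimately have "(\<lambda>n. g (x + z n)) \<longlonglongrightarrow> g x" by (rule isCont_tendsto_compose)
      then have "(\<lambda>n. (cmod (g (x + z n) - g x))\<^sup>2) \<longlonglongrightarrow> (cmod (g x - g x))\<^sup>2" by (intro tendsto_intros)
      then show "(\<lambda>n. (cmod (g (x + z n) - g x))\<^sup>2) \<longlonglongrightarrow> 0" by simp
    qed
    show "AE x in lborel. norm ((cmod (g (x + z n) - g x))\<^sup>2) \<le> (2 * M)\<^sup>2 * indicator {-(a + B)..a + B} x" for n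
    proof (rule AE_I2)
      fix x
      have "cmod (g (x + z n) - g x) \<le> 2 * M"
        using norm_triangle_ineq4[of "g (x + z n)" "g x"] gb[of x] gb[of "x + z n"] by simp
      then have "(cmod (g (x + z n) - g x))\<^sup>2 \<le> (2 * M)\<^sup>2" by (intro power_mono) auto
      moreover have "g (x + z n) = 0 \<and> g x = 0" if "x \<notin> {-(a + B)..a + B}"
        using that B[of n] by (intro conjI gs) auto
      ultimately show "norm ((cmod (g (x + z n) - g x))\<^sup>2) \<le> (2 * M)\<^sup>2 * indicator {-(a + B)..a + B} x"
        by (auto split: split_indicator)
    qed
  qed auto
  then show ?thesis by simp
qed

lemma L2_translation_continuous:
  assumes h: "is_L2 h" and z: "z \<longlonglongrightarrow> 0"
  shows "(\<lambda>n. LINT x|lborel. (cmod (h (x + z n) - h x))\<^sup>2) \<longlonglongrightarrow> 0"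
proof (rule LIMSEQ_I)
  fix e :: real assume e: "e > 0"
  obtain g M a where g: "continuous_on UNIV g" "\<And>x. cmod (g x) \<le> M" "\<And>x. x \<notin> {-a..a} \<Longrightarrow> g x = 0"
    and hg: "(LINT x|lborel. (cmod (h x - g x))\<^sup>2) < e / 12"
    using L2_dense_continuous[OF h, of "e / 12"] e by auto
  have g2: "is_L2 g"
    by (rule is_L2_bounded_support[OF _ g(2,3)]) (auto intro: borel_measurable_continuous_onI g)
  have tr: "is_L2 (\<lambda>x. u (x + c))" if "is_L2 u" for u c
    using is_L2_affine[OF that, of 1 c] by (simp add: add.commute)
  have "eventually (\<lambda>n. (LINT x|lborel. (cmod (g (x + z n) - g x))\<^sup>2) < e / 12) sequentially"
    using L2_translation_continuous_bump[OF g z] e by (intro order_tendstoD) auto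
  then have "eventually (\<lambda>n. (LINT x|lborel. (cmod (h (x + z n) - h x))\<^sup>2) < e) sequentially"
  proof eventually_elim
    case (elim n)
    have ints: "integrable lborel (\<lambda>x. (cmod (h (x + z n) - h x))\<^sup>2)"
      "integrable lborel (\<lambda>x. (cmod (h (x + z n) - g (x + z n)))\<^sup>2)"
      "integrable lborel (\<lambda>x. (cmod (g (x + z n) - g x))\<^sup>2)"
      "integrable lborel (\<lambda>x. (cmod (h x - g x))\<^sup>2)"
      by (intro is_L2_D(3) is_L2_diff tr h g2)+
    have "(LINT x|lborel. (cmod (h (x + z n) - h x))\<^sup>2)
      \<le> (LINT x|lborel. 4 * (cmod (h (x + z n) - g (x + z n)))\<^sup>2 + 4 * (cmod (g (x + z n) - g x))\<^sup>2 + 2 * (cmod (h x - g x))\<^sup>2)"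
    proof (rule integral_mono)
      show "(cmod (h (x + z n) - h x))\<^sup>2 \<le> 4 * (cmod (h (x + z n) - g (x + z n)))\<^sup>2 + 4 * (cmod (g (x + z n) - g x))\<^sup>2 + 2 * (cmod (h x - g x))\<^sup>2" for x
        using cmod_diff_sq_le_2[of "h (x + z n) - g x" "h x - g x"]
          cmod_add_sq_le_2[of "h (x + z n) - g (x + z n)" "g (x + z n) - g x"] by simp
    qed (use ints in auto)
    also have "\<dots> = 4 * (LINT x|lborel. (cmod (h (x + z n) - g (x + z n)))\<^sup>2) + 4 * (LINT x|lborel. (cmod (g (x + z n) - g x))\<^sup>2)
        + 2 * (LINT x|lborel. (cmod (h x - g x))\<^sup>2)"
      using ints by simp
    also have "(LINT x|lborel. (cmod (h (x + z n) - g (x + z n)))\<^sup>2) = (LINT x|lborel. (cmod (h x - g x))\<^sup>2)"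
      using lborel_integral_real_affine[of 1 "\<lambda>x. (cmod (h x - g x))\<^sup>2" "z n"] by (simp add: add.commute)
    also have "4 * (LINT x|lborel. (cmod (h x - g x))\<^sup>2) + 4 * (LINT x|lborel. (cmod (g (x + z n) - g x))\<^sup>2)
        + 2 * (LINT x|lborel. (cmod (h x - g x))\<^sup>2) < e"
      using elim hg e by linarith
    finally show ?case .
  qed
  then show "\<exists>no. \<forall>n\<ge>no. norm ((LINT x|lborel. (cmod (h (x + z n) - h x))\<^sup>2) - 0) < e"
    by (auto simp: eventually_sequentially)
qed

lemma borel_measurable_fourier [measurable]:
  assumes [measurable]: "h \<in> borel_measurable borel"
  shows "fourier h \<in> borel_measurable borel"
proof -
  have "(\<lambda>\<xi>. LINT x|lborel. cis (- \<xi> * x) * h x) \<in> borel_measurable borel"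
    by (rule sigma_finite_measure.borel_measurable_lebesgue_integral) (unfold_locales, measurable)
  then show ?thesis unfolding fourier_def[abs_def] by measurable
qed

lemma fourier_bounded:
  assumes "integrable lborel h"
  shows "cmod (fourier h \<xi>) \<le> 1 / sqrt (2 * pi) * (LINT x|lborel. cmod (h x))"
proof -
  have "cmod (LINT x|lborel. cis (- \<xi> * x) * h x) \<le> (LINT x|lborel. cmod (cis (- \<xi> * x) * h x))"
    by (rule integral_norm_bound)
  then show ?thesis
    unfolding fourier_def norm_mult by (intro mult_mono) (auto simp: norm_mult norm_divide)
qed

lemma integral_cnj: "(LINT x|M. cnj (f x)) = cnj (LINT x|M. f x)"
proof (cases "integrable M f")
  case True
  then show ?thesis by (rule integral_bounded_linear[OF bounded_linear_cnj])
next
  case False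
  then have "\<not> integrable M (\<lambda>x. cnj (f x))"
    using integrable_bounded_linear[OF bounded_linear_cnj, of M "\<lambda>x. cnj (f x)"] by auto
  with False show ?thesis by (simp add: not_integrable_integral_eq)
qed

lemma fourier_reflect: "fourier (\<lambda>x. h (- x)) \<xi> = fourier h (- \<xi>)"
  unfolding fourier_def
  using lborel_integral_real_affine[of "-1" "\<lambda>x. cis (- (-\<xi>) * x) * h x" 0] by simp

lemma fourier_cnj: "fourier (\<lambda>x. cnj (h x)) \<xi> = cnj (fourier h (- \<xi>))"
  unfolding fourier_def by (simp add: integral_cnj[symmetric] cis_cnj)

lemma fourier_gaussian:
  assumes "\<epsilon> > 0"
  shows "integrable lborel (\<lambda>\<xi>. complex_of_real (exp (- (\<epsilon> * \<xi>)\<^sup>2 / 2)))"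
    and "fourier (\<lambda>\<xi>. complex_of_real (exp (- (\<epsilon> * \<xi>)\<^sup>2 / 2))) z = complex_of_real (exp (- (z / \<epsilon>)\<^sup>2 / 2) / \<epsilon>)"
proof -
  have dens: "exp (- x\<^sup>2 / 2) = sqrt (2 * pi) * std_normal_density x" for x
    by (simp add: std_normal_density_def)
  have int: "integrable lborel (\<lambda>x. complex_of_real (exp (- x\<^sup>2 / 2)))"
    unfolding dens by (intro integrable_of_real integrable_mult_right) auto
  from lborel_integrable_real_affine[OF int, of \<epsilon> 0] assms
  show "integrable lborel (\<lambda>\<xi>. complex_of_real (exp (- (\<epsilon> * \<xi>)\<^sup>2 / 2)))" by simp
  have "(LINT x|lborel. std_normal_density x *\<^sub>R cis (t * x)) = exp (- t\<^sup>2 / 2)" for t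
    using fun_cong[OF char_std_normal_distribution, of t]
    by (simp add: char_def integral_density cis_conv_exp)
  note ch = this
  have "(LINT \<xi>|lborel. cis (- z * \<xi>) * complex_of_real (exp (- (\<epsilon> * \<xi>)\<^sup>2 / 2)))
     = (1 / \<epsilon>) *\<^sub>R (LINT x|lborel. cis (- z * (0 + 1 / \<epsilon> * x)) * complex_of_real (exp (- (\<epsilon> * (0 + 1 / \<epsilon> * x))\<^sup>2 / 2)))"
    by (subst lborel_integral_real_affine[of "1 / \<epsilon>" _ 0]) (use assms in auto)
  also have "\<dots> = (1 / \<epsilon>) *\<^sub>R (LINT x|lborel. of_real (sqrt (2 * pi)) * (std_normal_density x *\<^sub>R cis ((- z / \<epsilon>) * x)))"
    using assms by (intro arg_cong2[where f = scaleR] refl Bochner_Integration.integral_cong)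
       (simp_all add: std_normal_density_def scaleR_conv_of_real)
  also have "\<dots> = (1 / \<epsilon>) *\<^sub>R (of_real (sqrt (2 * pi)) * exp (- (- z / \<epsilon>)\<^sup>2 / 2))"
    unfolding integral_mult_right_zero ch by (simp add: scaleR_conv_of_real)
  finally show "fourier (\<lambda>\<xi>. complex_of_real (exp (- (\<epsilon> * \<xi>)\<^sup>2 / 2))) z = complex_of_real (exp (- (z / \<epsilon>)\<^sup>2 / 2) / \<epsilon>)"
    unfolding fourier_def by (simp add: scaleR_conv_of_real)
qed


lemma Re_autocorrelation:
  assumes h: "is_L2 h"
  shows "Re (convol h (\<lambda>y. cnj (h (- y))) z) =
    (LINT x|lborel. (cmod (h x))\<^sup>2) - (LINT x|lborel. (cmod (h (x + z) - h x))\<^sup>2) / 2"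
proof -
  have hm[measurable]: "h \<in> borel_measurable borel" using h by (simp add: is_L2_def)
  have hz: "is_L2 (\<lambda>x. h (x + z))"
    using is_L2_affine[OF h, of 1 z] by (simp add: add.commute)
  have "convol h (\<lambda>y. cnj (h (- y))) z = (LINT x|lborel. h (x + z) * cnj (h x))"
    unfolding convol_def
    by (subst lborel_integral_real_affine[of "-1" _ 0]) (auto simp: add.commute)
  moreover have int: "integrable lborel (\<lambda>x. h (x + z) * cnj (h x))"
    by (intro is_L2_integrable_mult hz is_L2_cnj h)
  ultimately have "Re (convol h (\<lambda>y. cnj (h (- y))) z) = (LINT x|lborel. Re (h (x + z) * cnj (h x)))"
    by (simp only: integral_Re)
  also have "\<dots> = (LINT x|lborel. ((cmod (h (x + z)))\<^sup>2 + (cmod (h x))\<^sup>2 - (cmod (h (x + z) - h x))\<^sup>2) / 2)"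
    unfolding cmod_power2 by (intro Bochner_Integration.integral_cong) (auto simp: power2_eq_square algebra_simps)
  also have "\<dots> = ((LINT x|lborel. (cmod (h (x + z)))\<^sup>2) + (LINT x|lborel. (cmod (h x))\<^sup>2)
      - (LINT x|lborel. (cmod (h (x + z) - h x))\<^sup>2)) / 2"
    using is_L2_D(3)[OF h] is_L2_D(3)[OF hz] is_L2_D(3)[OF is_L2_diff[OF hz h]] by simp
  also have "(LINT x|lborel. (cmod (h (x + z)))\<^sup>2) = (LINT x|lborel. (cmod (h x))\<^sup>2)"
    using lborel_integral_real_affine[of 1 "\<lambda>x. (cmod (h x))\<^sup>2" z] by (simp add: add.commute)
  finally show ?thesis by (simp add: field_simps)
qed

lemma fourier_gaussian_regularised:
  assumes h: "is_L2 h" and hi: "integrable lborel h" and e: "\<epsilon> > 0"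
  shows "integrable lborel (\<lambda>\<xi>. (cmod (fourier h \<xi>))\<^sup>2 * exp (- (\<epsilon> * \<xi>)\<^sup>2 / 2))"
    and "(LINT \<xi>|lborel. (cmod (fourier h \<xi>))\<^sup>2 * exp (- (\<epsilon> * \<xi>)\<^sup>2 / 2)) =
      (LINT w|lborel. Re (convol h (\<lambda>y. cnj (h (- y))) (\<epsilon> * w)) * std_normal_density w)"
proof -
  have hm[measurable]: "h \<in> borel_measurable borel" using h by (simp add: is_L2_def)
  let ?\<gamma> = "\<lambda>\<xi>. complex_of_real (exp (- (\<epsilon> * \<xi>)\<^sup>2 / 2))"
  let ?h' = "\<lambda>y. cnj (h (- y))"
  define a where "a = convol h ?h'"
  have hi': "integrable lborel ?h'"
    using integrable_bounded_linear[OF bounded_linear_cnj lborel_integrable_real_affine[OF hi, of "-1" 0]] by simp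
  have ai: "integrable lborel a" unfolding a_def by (rule integrable_convol[OF hi hi'])
  have am[measurable]: "a \<in> borel_measurable borel" using ai by (auto dest: borel_measurable_integrable)
  have gi: "integrable lborel ?\<gamma>" by (rule fourier_gaussian(1)[OF e])
  define B where "B = 1 / sqrt (2 * pi) * (LINT x|lborel. cmod (h x))"
  have B: "cmod (fourier h \<xi>) \<le> B" for \<xi>
    unfolding B_def by (rule fourier_bounded[OF hi])
  show int: "integrable lborel (\<lambda>\<xi>. (cmod (fourier h \<xi>))\<^sup>2 * exp (- (\<epsilon> * \<xi>)\<^sup>2 / 2))"
  proof (rule Bochner_Integration.integrable_bound)
    show "integrable lborel (\<lambda>\<xi>. of_real (B\<^sup>2) * ?\<gamma> \<xi>)" using gi by auto
    show "AE x in lborel. norm ((cmod (fourier h x))\<^sup>2 * exp (- (\<epsilon> * x)\<^sup>2 / 2)) \<le> norm (of_real (B\<^sup>2) * ?\<gamma> x)"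
      using B by (auto intro!: AE_I2 mult_right_mono power_mono simp: norm_mult norm_power abs_mult)
  qed measurable
  have fa: "fourier a \<xi> = of_real (sqrt (2 * pi) * (cmod (fourier h \<xi>))\<^sup>2)" for \<xi>
  proof -
    have "fourier ?h' \<xi> = cnj (fourier h \<xi>)"
      using fourier_cnj[of "\<lambda>y. h (- y)" \<xi>] fourier_reflect[of h "-\<xi>"] by simp
    then show ?thesis
      unfolding a_def fourier_convol[OF hi hi'] of_real_mult complex_norm_square by (simp add: mult.assoc)
  qed
  have "of_real (sqrt (2 * pi) * (LINT \<xi>|lborel. (cmod (fourier h \<xi>))\<^sup>2 * exp (- (\<epsilon> * \<xi>)\<^sup>2 / 2)))
      = (LINT \<xi>|lborel. fourier a \<xi> * ?\<gamma> \<xi>)"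
    unfolding fa integral_mult_right_zero[symmetric] integral_complex_of_real[symmetric]
    by (simp add: mult.assoc)
  also have "\<dots> = (LINT z|lborel. a z * fourier ?\<gamma> z)"
    by (rule fourier_exchange[OF ai gi])
  also have "\<dots> = (LINT z|lborel. a z * complex_of_real (exp (- (z / \<epsilon>)\<^sup>2 / 2) / \<epsilon>))"
    unfolding fourier_gaussian(2)[OF e] ..
  also have "\<dots> = \<epsilon> *\<^sub>R (LINT w|lborel. a (0 + \<epsilon> * w) * complex_of_real (exp (- ((0 + \<epsilon> * w) / \<epsilon>)\<^sup>2 / 2) / \<epsilon>))"
    by (subst lborel_integral_real_affine[of \<epsilon> _ 0]) (use e in auto)
  also have "\<dots> = (LINT w|lborel. a (\<epsilon> * w) * complex_of_real (sqrt (2 * pi) * std_normal_density w))"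
    unfolding integral_scaleR_right[symmetric] using e
    by (intro Bochner_Integration.integral_cong) (simp_all add: std_normal_density_def scaleR_conv_of_real)
  finally have *: "of_real (sqrt (2 * pi) * (LINT \<xi>|lborel. (cmod (fourier h \<xi>))\<^sup>2 * exp (- (\<epsilon> * \<xi>)\<^sup>2 / 2)))
    = (LINT w|lborel. a (\<epsilon> * w) * complex_of_real (sqrt (2 * pi) * std_normal_density w))" .
  have "integrable lborel (\<lambda>w. a (0 + \<epsilon> * w))"
    by (rule lborel_integrable_real_affine[OF ai]) (use e in auto)
  then have aei: "integrable lborel (\<lambda>w. a (\<epsilon> * w) * complex_of_real (sqrt (2 * pi) * std_normal_density w))"
  proof (rule Bochner_Integration.integrable_bound)
    show "AE w in lborel. norm (a (\<epsilon> * w) * complex_of_real (sqrt (2 * pi) * std_normal_density w)) \<le> norm (a (0 + \<epsilon> * w))"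
      by (auto intro!: AE_I2 simp: norm_mult std_normal_density_def mult_left_le)
  qed measurable
  have "sqrt (2 * pi) * (LINT \<xi>|lborel. (cmod (fourier h \<xi>))\<^sup>2 * exp (- (\<epsilon> * \<xi>)\<^sup>2 / 2))
    = (LINT w|lborel. Re (a (\<epsilon> * w) * complex_of_real (sqrt (2 * pi) * std_normal_density w)))"
    using arg_cong[OF *, of Re] by (simp only: Re_complex_of_real integral_Re[OF aei])
  also have "\<dots> = (LINT w|lborel. sqrt (2 * pi) * (Re (a (\<epsilon> * w)) * std_normal_density w))"
    by (intro Bochner_Integration.integral_cong) auto
  finally show "(LINT \<xi>|lborel. (cmod (fourier h \<xi>))\<^sup>2 * exp (- (\<epsilon> * \<xi>)\<^sup>2 / 2)) =
      (LINT w|lborel. Re (convol h (\<lambda>y. cnj (h (- y))) (\<epsilon> * w)) * std_normal_density w)"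
    unfolding integral_mult_right_zero a_def by simp
qed

text \<open>The regularised identity expresses the left-hand side as a Gaussian average of the autocorrelation of \<open>h\<close>,
  which is continuous at \<open>0\<close> because translation is continuous in the mean.\<close>
theorem plancherel:
  assumes h: "is_L2 h" and hi: "integrable lborel h"
  shows "is_L2 (fourier h)" "(LINT \<xi>|lborel. (cmod (fourier h \<xi>))\<^sup>2) = (LINT x|lborel. (cmod (h x))\<^sup>2)"
proof -
  have hm[measurable]: "h \<in> borel_measurable borel" using h by (simp add: is_L2_def)
  let ?H = "LINT x|lborel. (cmod (h x))\<^sup>2"
  define \<epsilon> where "\<epsilon> = (\<lambda>n. 1 / real (Suc n))"
  have e: "\<epsilon> n > 0" for n by (simp add: \<epsilon>_def)
  have e0: "\<epsilon> \<longlonglongrightarrow> 0" unfolding \<epsilon>_def using lim_inverse_n' by (rule LIMSEQ_Suc)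
  have [measurable]: "(\<lambda>z. LINT x|lborel. (cmod (h (x + z) - h x))\<^sup>2) \<in> borel_measurable borel"
    by (rule sigma_finite_measure.borel_measurable_lebesgue_integral) (unfold_locales, measurable)
  have "(\<lambda>n. LINT w|lborel. (?H - (LINT x|lborel. (cmod (h (x + \<epsilon> n * w) - h x))\<^sup>2) / 2) * std_normal_density w)
    \<longlonglongrightarrow> (LINT w|lborel. ?H * std_normal_density w)"
  proof (rule integral_dominated_convergence[where w = "\<lambda>w. 3 * ?H * std_normal_density w"])
    show "AE w in lborel. (\<lambda>n. (?H - (LINT x|lborel. (cmod (h (x + \<epsilon> n * w) - h x))\<^sup>2) / 2) * std_normal_density w)
       \<longlonglongrightarrow> ?H * std_normal_density w"
    proof (rule AE_I2)
      fix w
      have "(\<lambda>n. \<epsilon> n * w) \<longlonglongrightarrow> 0" using tendsto_mult[OF e0 tendsto_const[of w]] by simp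
      from L2_translation_continuous[OF h this]
      have "(\<lambda>n. (?H - (LINT x|lborel. (cmod (h (x + \<epsilon> n * w) - h x))\<^sup>2) / 2) * std_normal_density w)
       \<longlonglongrightarrow> (?H - 0 / 2) * std_normal_density w"
        by (intro tendsto_intros) auto
      then show "(\<lambda>n. (?H - (LINT x|lborel. (cmod (h (x + \<epsilon> n * w) - h x))\<^sup>2) / 2) * std_normal_density w)
       \<longlonglongrightarrow> ?H * std_normal_density w" by simp
    qed
    have bd: "(LINT x|lborel. (cmod (h (x + z) - h x))\<^sup>2) \<le> 4 * ?H" for z
    proof -
      have hz: "is_L2 (\<lambda>x. h (x + z))"
        using is_L2_affine[OF h, of 1 z] by (simp add: add.commute)
      have "(LINT x|lborel. (cmod (h (x + z) - h x))\<^sup>2) \<le> (LINT x|lborel. 2 * (cmod (h (x + z)))\<^sup>2 + 2 * (cmod (h x))\<^sup>2)"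
        by (intro integral_mono cmod_diff_sq_le_2)
           (use is_L2_D(3)[OF h] is_L2_D(3)[OF hz] is_L2_D(3)[OF is_L2_diff[OF hz h]] in auto)
      also have "\<dots> = 2 * (LINT x|lborel. (cmod (h (x + z)))\<^sup>2) + 2 * ?H"
        using is_L2_D(3)[OF h] is_L2_D(3)[OF hz] by simp
      also have "(LINT x|lborel. (cmod (h (x + z)))\<^sup>2) = ?H"
        using lborel_integral_real_affine[of 1 "\<lambda>x. (cmod (h x))\<^sup>2" z] by (simp add: add.commute)
      finally show ?thesis by simp
    qed
    show "AE w in lborel. norm ((?H - (LINT x|lborel. (cmod (h (x + \<epsilon> n * w) - h x))\<^sup>2) / 2) * std_normal_density w)
      \<le> 3 * ?H * std_normal_density w" for n
    proof (rule AE_I2)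
      fix w
      let ?X = "LINT x|lborel. (cmod (h (x + \<epsilon> n * w) - h x))\<^sup>2"
      have "0 \<le> ?X" "0 \<le> ?H" by auto
      then have "\<bar>?H - ?X / 2\<bar> \<le> 3 * ?H" using bd[of "\<epsilon> n * w"] unfolding abs_le_iff by linarith
      then show "norm ((?H - ?X / 2) * std_normal_density w) \<le> 3 * ?H * std_normal_density w"
        by (simp add: abs_mult mult_right_mono)
    qed
  qed auto
  then have lim: "(\<lambda>n. LINT \<xi>|lborel. (cmod (fourier h \<xi>))\<^sup>2 * exp (- (\<epsilon> n * \<xi>)\<^sup>2 / 2)) \<longlonglongrightarrow> ?H"
    unfolding fourier_gaussian_regularised(2)[OF h hi e] Re_autocorrelation[OF h] by simp
  have mono: "AE x in lborel. mono (\<lambda>n. (cmod (fourier h x))\<^sup>2 * exp (- (\<epsilon> n * x)\<^sup>2 / 2))"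
  proof (intro AE_I2 monoI mult_left_mono)
    fix x :: real and m n :: nat assume "m \<le> n"
    then have "\<epsilon> n \<le> \<epsilon> m" by (simp add: \<epsilon>_def frac_le)
    then have "(\<epsilon> n)\<^sup>2 * x\<^sup>2 \<le> (\<epsilon> m)\<^sup>2 * x\<^sup>2"
      using e[of n] by (intro mult_right_mono power_mono) auto
    then show "exp (- (\<epsilon> m * x)\<^sup>2 / 2) \<le> exp (- (\<epsilon> n * x)\<^sup>2 / 2)" by (simp add: power_mult_distrib)
  qed auto
  have ptw: "AE x in lborel. (\<lambda>n. (cmod (fourier h x))\<^sup>2 * exp (- (\<epsilon> n * x)\<^sup>2 / 2)) \<longlonglongrightarrow> (cmod (fourier h x))\<^sup>2"
  proof (rule AE_I2)
    fix x
    have "(\<lambda>n. (cmod (fourier h x))\<^sup>2 * exp (- (\<epsilon> n * x)\<^sup>2 / 2)) \<longlonglongrightarrow> (cmod (fourier h x))\<^sup>2 * exp (- (0 * x)\<^sup>2 / 2)"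
      by (intro tendsto_intros e0) auto
    then show "(\<lambda>n. (cmod (fourier h x))\<^sup>2 * exp (- (\<epsilon> n * x)\<^sup>2 / 2)) \<longlonglongrightarrow> (cmod (fourier h x))\<^sup>2" by simp
  qed
  note mc = integral_monotone_convergence_nonneg[OF fourier_gaussian_regularised(1)[OF h hi e] mono _ ptw lim]
  show "is_L2 (fourier h)" unfolding is_L2_def using mc(1) by auto
  show "(LINT \<xi>|lborel. (cmod (fourier h \<xi>))\<^sup>2) = ?H" using mc(2) by auto
qed

lemma L2_inner_expand:
  assumes f: "is_L2 f" and g: "is_L2 g"
  shows "(LINT x|lborel. (cmod (f x - g x))\<^sup>2) = (LINT x|lborel. (cmod (f x))\<^sup>2) + (LINT x|lborel. (cmod (g x))\<^sup>2)
    - 2 * Re (LINT x|lborel. f x * cnj (g x))"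
proof -
  have int: "integrable lborel (\<lambda>x. f x * cnj (g x))"
    by (intro is_L2_integrable_mult f is_L2_cnj g)
  have "(LINT x|lborel. (cmod (f x - g x))\<^sup>2) = (LINT x|lborel. (cmod (f x))\<^sup>2 + (cmod (g x))\<^sup>2 - 2 * Re (f x * cnj (g x)))"
    unfolding cmod_power2 by (intro Bochner_Integration.integral_cong) (auto simp: power2_eq_square algebra_simps)
  also have "\<dots> = (LINT x|lborel. (cmod (f x))\<^sup>2) + (LINT x|lborel. (cmod (g x))\<^sup>2) - 2 * (LINT x|lborel. Re (f x * cnj (g x)))"
    using is_L2_D(3)[OF f] is_L2_D(3)[OF g] integrable_Re[OF int] by (simp del: times_complex.sel)
  finally show ?thesis by (simp only: integral_Re[OF int])
qed

lemma plancherel_inverse: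
  assumes u: "is_L2 u" "integrable lborel u" and h: "is_L2 h" "integrable lborel h"
  shows "is_L2 (\<lambda>x. fourier u (- x))"
    and "(LINT x|lborel. (cmod (fourier u (- x) - h x))\<^sup>2) = (LINT \<xi>|lborel. (cmod (u \<xi> - fourier h \<xi>))\<^sup>2)"
proof -
  let ?h = "\<lambda>x. cnj (h (- x))"
  have [measurable]: "h \<in> borel_measurable borel" "u \<in> borel_measurable borel" using h u by (auto simp: is_L2_def)
  have hi': "integrable lborel ?h"
    using integrable_bounded_linear[OF bounded_linear_cnj lborel_integrable_real_affine[OF h(2), of "-1" 0]] by simp
  show ui: "is_L2 (\<lambda>x. fourier u (- x))"
    using is_L2_affine[OF plancherel(1)[OF u], of "-1" 0] by simp
  have 1: "(LINT x|lborel. (cmod (fourier u (- x)))\<^sup>2) = (LINT x|lborel. (cmod (u x))\<^sup>2)"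
    unfolding plancherel(2)[OF u, symmetric]
    using lborel_integral_real_affine[of "-1" "\<lambda>x. (cmod (fourier u x))\<^sup>2" 0] by simp
  have "(LINT x|lborel. fourier u (- x) * cnj (h x)) = (LINT x|lborel. fourier u x * ?h x)"
    using lborel_integral_real_affine[of "-1" "\<lambda>x. fourier u x * ?h x" 0] by simp
  also have "\<dots> = (LINT x|lborel. u x * fourier ?h x)"
    by (rule fourier_exchange[OF u(2) hi'])
  also have "\<dots> = (LINT x|lborel. u x * cnj (fourier h x))"
    using fourier_cnj[of "\<lambda>y. h (- y)"] fourier_reflect[of h] by simp
  finally have 2: "(LINT x|lborel. fourier u (- x) * cnj (h x)) = (LINT x|lborel. u x * cnj (fourier h x))" .
  show "(LINT x|lborel. (cmod (fourier u (- x) - h x))\<^sup>2) = (LINT \<xi>|lborel. (cmod (u \<xi> - fourier h \<xi>))\<^sup>2)"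
    unfolding L2_inner_expand[OF ui h(1)] L2_inner_expand[OF u(1) plancherel(1)[OF h]] 1 2 plancherel(2)[OF h] ..
qed

section \<open>Fresnel integrals\<close>

definition fresnel :: "real \<Rightarrow> complex" where
  "fresnel x = complex_of_real (FresnelC x) + \<i> * complex_of_real (FresnelS x)"

lemma theta_tilde_fresnel: "theta_tilde y = 1/2 - (1 - \<i>) / 2 * fresnel (- y / sqrt pi)"
  by (simp add: theta_tilde_def fresnel_def)

lemma cis_has_vector_derivative:
  assumes "(g has_real_derivative g') (at x within S)"
  shows "((\<lambda>x. cis (g x)) has_vector_derivative (\<i> * of_real g' * cis (g x))) (at x within S)"
  using has_derivative_cis[OF assms[unfolded has_field_derivative_def]]
  by (simp add: has_vector_derivative_def scaleR_conv_of_real mult_ac)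

lemma FresnelC_has_derivative: "(FresnelC has_real_derivative cos (pi / 2 * x\<^sup>2)) (at x)"
  and FresnelS_has_derivative: "(FresnelS has_real_derivative sin (pi / 2 * x\<^sup>2)) (at x)"
proof -
  let ?a = "-(\<bar>x\<bar> + 1)" and ?b = "\<bar>x\<bar> + 1"
  have at: "at x within {?a..?b} = at x"
    by (rule at_within_interior) (auto simp: interior_atLeastAtMost_real)
  have "((\<lambda>u. LBINT y=(0::real)..u. f y) has_vector_derivative f x) (at x)" if "continuous_on {?a..?b} f" for f :: "real \<Rightarrow> real"
    unfolding at[symmetric]
    by (rule interval_integral_FTC2) (use that in auto)
  note * = this[unfolded zero_ereal_def[symmetric]]
  show "(FresnelC has_real_derivative cos (pi / 2 * x\<^sup>2)) (at x)"
    unfolding FresnelC_def[abs_def] has_real_derivative_iff_has_vector_derivative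
    by (rule *) (intro continuous_intros)
  show "(FresnelS has_real_derivative sin (pi / 2 * x\<^sup>2)) (at x)"
    unfolding FresnelS_def[abs_def] has_real_derivative_iff_has_vector_derivative
    by (rule *) (intro continuous_intros)
qed

lemma fresnel_has_derivative: "(fresnel has_vector_derivative cis (pi / 2 * x\<^sup>2)) (at x)"
proof -
  have "((\<lambda>x. complex_of_real (FresnelC x) + \<i> * complex_of_real (FresnelS x)) has_vector_derivative
      (complex_of_real (cos (pi / 2 * x\<^sup>2)) + \<i> * complex_of_real (sin (pi / 2 * x\<^sup>2)))) (at x)"
    by (intro has_vector_derivative_add has_vector_derivative_mult_right has_vector_derivative_of_real
        FresnelC_has_derivative FresnelS_has_derivative)
  moreover have "complex_of_real (cos (pi / 2 * x\<^sup>2)) + \<i> * complex_of_real (sin (pi / 2 * x\<^sup>2)) = cis (pi / 2 * x\<^sup>2)"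
    by (auto simp: complex_eq_iff)
  ultimately show ?thesis by (simp add: fresnel_def[abs_def])
qed

lemma fresnel_0 [simp]: "fresnel 0 = 0"
  by (simp add: fresnel_def FresnelC_def FresnelS_def zero_ereal_def[symmetric])

lemma fresnel_scaled_has_derivative:
  "((\<lambda>t. fresnel (c * t + d)) has_vector_derivative (c * cis (pi / 2 * (c * t + d)\<^sup>2))) (at t within S)"
proof -
  have "((\<lambda>t. c * t + d) has_vector_derivative c) (at t within S)"
    unfolding has_real_derivative_iff_has_vector_derivative[symmetric]
    by (auto intro!: derivative_eq_intros)
  from vector_diff_chain_within[OF this has_vector_derivative_at_within[OF fresnel_has_derivative]]
  show ?thesis by (simp add: o_def scaleR_conv_of_real)
qed

lemma fresnel_minus: "fresnel (- x) = - fresnel x"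
proof -
  have "((\<lambda>x. fresnel (1 * x + 0) + fresnel ((-1) * x + 0)) has_vector_derivative
     (of_real 1 * cis (pi / 2 * (1 * x + 0)\<^sup>2) + of_real (-1) * cis (pi / 2 * ((-1) * x + 0)\<^sup>2))) (at x within UNIV)" for x
    by (intro has_vector_derivative_add fresnel_scaled_has_derivative)
  then have "((\<lambda>x. fresnel x + fresnel (- x)) has_vector_derivative 0) (at x within UNIV)" for x
    by simp
  then obtain c where "\<And>x. fresnel x + fresnel (- x) = c"
    using has_vector_derivative_zero_constant[of UNIV "\<lambda>x. fresnel x + fresnel (- x)"] by auto
  from this[of x] this[of 0] show ?thesis by (simp add: eq_neg_iff_add_eq_0 add.commute)
qed

lemma theta_tilde_minus: "theta_tilde (- y) = 1 - theta_tilde y"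
  using fresnel_minus[of "y / sqrt pi"] by (simp add: theta_tilde_fresnel field_simps)

lemma continuous_fresnel: "continuous_on S fresnel"
  by (intro continuous_at_imp_continuous_on ballI has_vector_derivative_continuous[OF fresnel_has_derivative])

lemma fresnel_tail:
  assumes "0 < x" "x \<le> y"
  shows "cmod (fresnel y - fresnel x) \<le> 2 / (pi * x)"
proof (cases "x = y")
  case False
  then have xy: "x < y" using assms by simp
  define q where "q = (\<lambda>t. cis (pi / 2 * t\<^sup>2) * (\<i> * of_real (1 / (pi * t))))"
  have dq: "((\<lambda>t. fresnel t + q t) has_vector_derivative - \<i> / of_real (pi * t\<^sup>2) * cis (pi / 2 * t\<^sup>2)) (at t)" if "t > 0" for t
  proof -
    have "((\<lambda>t. pi / 2 * t\<^sup>2) has_real_derivative pi * t) (at t)"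
      by (auto intro!: derivative_eq_intros)
    note 1 = cis_has_vector_derivative[OF this]
    have "((\<lambda>t. 1 / (pi * t)) has_real_derivative - (1 / (pi * t\<^sup>2))) (at t)"
      using that by (auto intro!: derivative_eq_intros simp: field_simps power2_eq_square)
    then have 2: "((\<lambda>t. \<i> * complex_of_real (1 / (pi * t))) has_vector_derivative \<i> * of_real (- (1 / (pi * t\<^sup>2)))) (at t)"
      by (intro has_vector_derivative_mult_right has_vector_derivative_of_real)
    from has_vector_derivative_add[OF fresnel_has_derivative[of t] has_vector_derivative_mult[OF 1 2]]
    show ?thesis unfolding q_def
      by (rule has_vector_derivative_eq_rhs) (use that in \<open>simp add: field_simps power2_eq_square\<close>)
  qed
  have "norm ((fresnel y + q y) - (fresnel x + q x)) \<le> - 1 / (pi * y) - (- 1 / (pi * x))"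
  proof (rule differentiable_bound_general[OF xy])
    show "continuous_on {x..y} (\<lambda>t. fresnel t + q t)"
      by (intro continuous_at_imp_continuous_on ballI has_vector_derivative_continuous[OF dq]) (use assms in auto)
    show "continuous_on {x..y} (\<lambda>t. - 1 / (pi * t))"
      using assms by (intro continuous_intros) auto
    show "((\<lambda>t. - 1 / (pi * t)) has_vector_derivative 1 / (pi * t\<^sup>2)) (at t)" if "x < t" for t
      unfolding has_real_derivative_iff_has_vector_derivative[symmetric]
      using that assms by (auto intro!: derivative_eq_intros simp: field_simps power2_eq_square)
    show "((\<lambda>t. fresnel t + q t) has_vector_derivative - \<i> / of_real (pi * t\<^sup>2) * cis (pi / 2 * t\<^sup>2)) (at t)" if "x < t" for t
      using dq[of t] that assms by simp
    show "cmod (- \<i> / of_real (pi * t\<^sup>2) * cis (pi / 2 * t\<^sup>2)) \<le> 1 / (pi * t\<^sup>2)" for t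
      by (simp add: norm_mult norm_divide norm_power)
  qed
  moreover have "cmod (q x) = 1 / (pi * x)" "cmod (q y) = 1 / (pi * y)"
    using assms by (auto simp: q_def norm_mult norm_divide)
  moreover have "fresnel y - fresnel x = ((fresnel y + q y) - (fresnel x + q x)) + (q x - q y)" by simp
  then have "cmod (fresnel y - fresnel x) \<le> cmod ((fresnel y + q y) - (fresnel x + q x)) + (cmod (q x) + cmod (q y))"
    by (metis norm_triangle_ineq norm_triangle_ineq4 add_left_mono order_trans)
  ultimately show ?thesis by simp
qed (use assms in simp)

lemma fresnel_le: "cmod (fresnel x) \<le> \<bar>x\<bar>"
proof -
  have pos: "cmod (fresnel y) \<le> y" if y: "y > 0" for y
  proof -
    have "norm (fresnel y - fresnel 0) \<le> y - 0"
      by (rule differentiable_bound_general[where \<phi> = "\<lambda>t. t" and \<phi>' = "\<lambda>_. 1", OF y continuous_fresnel])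
         (auto intro!: fresnel_has_derivative simp: has_vector_derivative_id[unfolded id_def])
    then show ?thesis by simp
  qed
  show ?thesis
    using pos[of x] pos[of "-x"] fresnel_minus[of x] by (cases x "0::real" rule: linorder_cases) auto
qed

lemma fresnel_bounded: "cmod (fresnel x) \<le> 2"
proof -
  have pos: "cmod (fresnel y) \<le> 2" if "y \<ge> 0" for y
  proof (cases "y \<le> 1")
    case True
    then show ?thesis using fresnel_le[of y] that by simp
  next
    case False
    have "cmod (fresnel y) \<le> cmod (fresnel y - fresnel 1) + cmod (fresnel 1)"
      using norm_triangle_ineq[of "fresnel y - fresnel 1" "fresnel 1"] by simp
    also have "\<dots> \<le> 2 / (pi * 1) + \<bar>1\<bar>"
      by (intro add_mono fresnel_tail fresnel_le) (use False in auto)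
    also have "\<dots> \<le> 2" using pi_gt3 by (simp add: field_simps)
    finally show ?thesis .
  qed
  show ?thesis using pos[of x] pos[of "-x"] fresnel_minus[of x] by (cases "x \<ge> 0") auto
qed

text \<open>Rules out the root \<open>- (1 + \<i>) / 2\<close> of \<open>\<i> / 2\<close> as a limit.\<close>
lemma FresnelC_1: "FresnelC 1 \<ge> 3 / 5"
proof -
  define d where "d = (\<lambda>t. FresnelC t - (t - pi\<^sup>2 * t ^ 5 / 40))"
  have "d 0 \<le> d 1"
  proof (rule DERIV_nonneg_imp_nondecreasing[OF zero_le_one], intro exI conjI)
    fix t :: real
    show "(d has_real_derivative cos (pi / 2 * t\<^sup>2) - (1 - pi\<^sup>2 * t ^ 4 / 8)) (at t)"
      unfolding d_def by (auto intro!: derivative_eq_intros FresnelC_has_derivative)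
    have "(sin (pi / 4 * t\<^sup>2))\<^sup>2 \<le> (pi / 4 * t\<^sup>2)\<^sup>2"
      using abs_sin_x_le_abs_x[of "pi / 4 * t\<^sup>2"] by (metis abs_le_square_iff)
    moreover have "cos (pi / 2 * t\<^sup>2) = 1 - 2 * (sin (pi / 4 * t\<^sup>2))\<^sup>2"
      using cos_double_sin[of "pi / 4 * t\<^sup>2"] by simp
    moreover have "(pi / 4 * t\<^sup>2)\<^sup>2 = pi\<^sup>2 * t ^ 4 / 16"
      by (simp add: power_mult_distrib power_divide)
    ultimately show "0 \<le> cos (pi / 2 * t\<^sup>2) - (1 - pi\<^sup>2 * t ^ 4 / 8)" by simp
  qed
  moreover have "pi\<^sup>2 \<le> 4\<^sup>2" using pi_less_4 by (intro power_mono) auto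
  moreover have "FresnelC 0 = 0" by (simp add: FresnelC_def zero_ereal_def[symmetric])
  ultimately show ?thesis by (simp add: d_def)
qed

lemma FresnelC_ge: assumes "x \<ge> 1" shows "FresnelC x \<ge> - 1 / 4"
proof -
  have "\<bar>Re (fresnel x - fresnel 1)\<bar> \<le> 2 / (pi * 1)"
    using abs_Re_le_cmod fresnel_tail[of 1 x] assms by (meson order_trans zero_less_one)
  moreover have "2 / pi \<le> 2 / 3" using pi_gt3 by (simp add: field_simps)
  ultimately show ?thesis using FresnelC_1 by (simp add: fresnel_def abs_le_iff)
qed


text \<open>The Fresnel analogue of the classical evaluation of the Gaussian integral: the square of the Fresnel
  integral and this parameter integral have the same derivative.\<close>
definition fresnel_sq_remainder :: "real \<Rightarrow> complex" where
  "fresnel_sq_remainder x = integral {0..1} (\<lambda>t. cis (pi / 2 * x\<^sup>2 * (1 + t\<^sup>2)) / (\<i> * of_real (pi / 2 * (1 + t\<^sup>2))))"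

lemma fresnel_sq_remainder_has_derivative:
  "(fresnel_sq_remainder has_vector_derivative 2 * cis (pi / 2 * x\<^sup>2) * fresnel x) (at x)"
proof -
  let ?f = "\<lambda>x t. cis (pi / 2 * x\<^sup>2 * (1 + t\<^sup>2)) / (\<i> * of_real (pi / 2 * (1 + t\<^sup>2)))"
  let ?f' = "\<lambda>(x::real) (t::real). 2 * of_real x * cis (pi / 2 * x\<^sup>2 * (1 + t\<^sup>2))"
  have nz: "1 + t\<^sup>2 \<noteq> 0" for t :: real
    using zero_le_power2[of t] by linarith
  have nzc: "\<i> * complex_of_real (pi / 2 * (1 + t\<^sup>2)) \<noteq> 0" for t :: real
    using nz[of t] pi_gt_zero by (simp del: of_real_add of_real_power)
  have "((\<lambda>x. integral (cbox 0 1) (?f x)) has_vector_derivative integral (cbox 0 1) (?f' x)) (at x within UNIV)"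
  proof (rule leibniz_rule_vector_derivative)
    fix x t :: real
    have "((\<lambda>x. pi / 2 * x\<^sup>2 * (1 + t\<^sup>2)) has_real_derivative (pi * x * (1 + t\<^sup>2))) (at x within UNIV)"
      by (auto intro!: derivative_eq_intros)
    from has_vector_derivative_divide[OF cis_has_vector_derivative[OF this], of "\<i> * of_real (pi / 2 * (1 + t\<^sup>2))"]
    show "((\<lambda>x. ?f x t) has_vector_derivative ?f' x t) (at x within UNIV)"
    proof (rule has_vector_derivative_eq_rhs)
      have div: "A * c / D = B * c" if "A = B * D" "D \<noteq> 0" for A B c D :: complex
        using that by simp
      show "\<i> * complex_of_real (pi * x * (1 + t\<^sup>2)) * cis (pi / 2 * x\<^sup>2 * (1 + t\<^sup>2)) / (\<i> * of_real (pi / 2 * (1 + t\<^sup>2))) = ?f' x t"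
        by (rule div[OF _ nzc]) simp
    qed
  next
    show "?f x integrable_on cbox 0 1" for x
      unfolding box_real by (intro integrable_continuous_interval continuous_intros nzc ballI)
    show "continuous_on (UNIV \<times> cbox 0 1) (\<lambda>(x, t). ?f' x t)"
      unfolding split_beta by (intro continuous_intros)
  qed auto
  moreover have "integral (cbox 0 1) (?f' x) = 2 * cis (pi / 2 * x\<^sup>2) * fresnel x"
  proof -
    have "((\<lambda>t. of_real x * cis (pi / 2 * (x * t + 0)\<^sup>2)) has_integral fresnel (x * 1 + 0) - fresnel (x * 0 + 0)) {0..1}"
      by (rule fundamental_theorem_of_calculus[OF zero_le_one fresnel_scaled_has_derivative])
    then have "((\<lambda>t. 2 * cis (pi / 2 * x\<^sup>2) * (of_real x * cis (pi / 2 * (x * t)\<^sup>2))) has_integral 2 * cis (pi / 2 * x\<^sup>2) * fresnel x) {0..1}"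
      by (intro has_integral_mult_right) simp
    moreover have "2 * cis (pi / 2 * x\<^sup>2) * (of_real x * cis (pi / 2 * (x * t)\<^sup>2)) = ?f' x t" for t
    proof -
      have "cis (pi / 2 * x\<^sup>2) * cis (pi / 2 * (x * t)\<^sup>2) = cis (pi / 2 * x\<^sup>2 * (1 + t\<^sup>2))"
        unfolding cis_mult by (rule arg_cong[of _ _ cis]) (simp add: field_simps)
      then show ?thesis by (simp add: mult_ac)
    qed
    ultimately have "(?f' x has_integral 2 * cis (pi / 2 * x\<^sup>2) * fresnel x) {0..1}" by (simp only:)
    then show ?thesis unfolding box_real by (rule integral_unique)
  qed
  ultimately show ?thesis by (simp only: fresnel_sq_remainder_def[abs_def] box_real)
qed

lemma fresnel_sq: "(fresnel x)\<^sup>2 = fresnel_sq_remainder x + \<i> / 2"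
proof -
  have "((\<lambda>x. fresnel x * fresnel x - fresnel_sq_remainder x) has_vector_derivative
    (fresnel x * cis (pi / 2 * x\<^sup>2) + cis (pi / 2 * x\<^sup>2) * fresnel x) - 2 * cis (pi / 2 * x\<^sup>2) * fresnel x) (at x)" for x
    by (intro has_vector_derivative_diff has_vector_derivative_mult fresnel_has_derivative fresnel_sq_remainder_has_derivative)
  then have "((\<lambda>x. fresnel x * fresnel x - fresnel_sq_remainder x) has_vector_derivative 0) (at x within UNIV)" for x
    by simp
  then obtain c where c: "\<And>x. fresnel x * fresnel x - fresnel_sq_remainder x = c"
    using has_vector_derivative_zero_constant[of UNIV "\<lambda>x. fresnel x * fresnel x - fresnel_sq_remainder x"] by auto
  have "((\<lambda>t. inverse (1 + t\<^sup>2)) has_integral arctan 1 - arctan 0) {0..1::real}"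
    by (rule fundamental_theorem_of_calculus)
       (auto simp: has_real_derivative_iff_has_vector_derivative[symmetric] intro: has_field_derivative_at_within[OF DERIV_arctan])
  then have "((\<lambda>t. complex_of_real (inverse (1 + t\<^sup>2))) has_integral complex_of_real (pi / 4)) {0..1::real}"
    by (intro has_integral_of_real) (simp add: arctan_one)
  then have "((\<lambda>t. (- 2 * \<i> / of_real pi) * complex_of_real (inverse (1 + t\<^sup>2))) has_integral (- 2 * \<i> / of_real pi) * complex_of_real (pi / 4)) {0..1::real}"
    by (rule has_integral_mult_right)
  moreover have "(- 2 * \<i> / of_real pi) * complex_of_real (inverse (1 + t\<^sup>2)) = cis (pi / 2 * 0\<^sup>2 * (1 + t\<^sup>2)) / (\<i> * of_real (pi / 2 * (1 + t\<^sup>2)))" for t :: real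
  proof -
    have "(- 2 * \<i> / p) * inverse D = 1 / (\<i> * (p / 2 * D))" for p D :: complex
      by (cases "p = 0"; cases "D = 0") (simp_all add: field_simps)
    from this[of "of_real pi" "of_real (1 + t\<^sup>2)"] show ?thesis
      by (simp only: of_real_inverse of_real_mult of_real_divide of_real_numeral) simp
  qed
  ultimately have "fresnel_sq_remainder 0 = - \<i> / 2"
    unfolding fresnel_sq_remainder_def by (simp add: integral_unique)
  with c[of 0] c[of x] show ?thesis by (simp add: power2_eq_square algebra_simps)
qed

lemma fresnel_sq_remainder_bound:
  assumes x: "x > 0"
  shows "cmod (fresnel_sq_remainder x) \<le> 5 / x"
proof -
  define V where "V = (\<lambda>t. of_real (1 / x) * fresnel (x * t + 0))"
  define w where "w = (\<lambda>t::real. complex_of_real (1 / (1 + t\<^sup>2)))"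
  define w' where "w' = (\<lambda>t::real. complex_of_real (- (2 * t) / (1 + t\<^sup>2)\<^sup>2))"
  have nz: "1 + t\<^sup>2 \<noteq> 0" for t :: real
    using zero_le_power2[of t] by linarith
  have V: "(V has_vector_derivative cis (pi / 2 * (x * t)\<^sup>2)) (at t within S)" for t S
    unfolding V_def using has_vector_derivative_mult_right[OF fresnel_scaled_has_derivative[of x 0 t S], of "of_real (1 / x)"] x
    by simp
  have w: "(w has_vector_derivative w' t) (at t within S)" for t S
    unfolding w_def w'_def using nz[of t]
    by (intro has_vector_derivative_of_real) (auto intro!: derivative_eq_intros simp: power2_eq_square field_simps)
  have Vb: "cmod (V t) \<le> 2 / x" for t
    using fresnel_bounded[of "x * t + 0"] x by (simp add: V_def norm_mult norm_divide field_simps)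
  have wb: "cmod (w' t) \<le> 2" if "t \<in> {0..1}" for t
  proof -
    have "1 \<le> (1 + t\<^sup>2)\<^sup>2" by (rule one_le_power) simp
    moreover have "\<bar>2 * t\<bar> \<le> 2" using that by auto
    ultimately have "\<bar>2 * t\<bar> / (1 + t\<^sup>2)\<^sup>2 \<le> 2 / 1" by (intro frac_le) auto
    then show ?thesis by (simp add: w'_def norm_divide norm_power norm_mult del: of_real_add of_real_power of_real_divide of_real_mult of_real_minus)
  qed
  have "((\<lambda>t. V t * w' t + cis (pi / 2 * (x * t)\<^sup>2) * w t) has_integral V 1 * w 1 - V 0 * w 0) {0..1}"
    by (rule fundamental_theorem_of_calculus[OF zero_le_one has_vector_derivative_mult[OF V w]])
  moreover have cV: "continuous_on {0..1} V"
    by (intro continuous_at_imp_continuous_on ballI has_vector_derivative_continuous[OF V])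
  have cw: "continuous_on {0..1} w'"
    unfolding w'_def by (intro continuous_intros ballI) (simp add: nz)
  have Vw: "(\<lambda>t. V t * w' t) integrable_on {0..1}"
    by (intro integrable_continuous_interval continuous_intros cV cw)
  ultimately have "((\<lambda>t. (V t * w' t + cis (pi / 2 * (x * t)\<^sup>2) * w t) - V t * w' t) has_integral
     (V 1 * w 1 - V 0 * w 0) - integral {0..1} (\<lambda>t. V t * w' t)) {0..1}"
    by (intro has_integral_diff integrable_integral)
  then have "((\<lambda>t. cis (pi / 2 * x\<^sup>2) / (\<i> * of_real (pi / 2)) * (cis (pi / 2 * (x * t)\<^sup>2) * w t)) has_integral
     cis (pi / 2 * x\<^sup>2) / (\<i> * of_real (pi / 2)) * (V 1 * w 1 - V 0 * w 0 - integral {0..1} (\<lambda>t. V t * w' t))) {0..1}"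
    by (intro has_integral_mult_right) simp
  moreover have "cis (pi / 2 * x\<^sup>2) / (\<i> * of_real (pi / 2)) * (cis (pi / 2 * (x * t)\<^sup>2) * w t)
     = cis (pi / 2 * x\<^sup>2 * (1 + t\<^sup>2)) / (\<i> * of_real (pi / 2 * (1 + t\<^sup>2)))" for t
  proof -
    have "cis (pi / 2 * x\<^sup>2) * cis (pi / 2 * (x * t)\<^sup>2) = cis (pi / 2 * x\<^sup>2 * (1 + t\<^sup>2))"
      unfolding cis_mult by (rule arg_cong[of _ _ cis]) (simp add: field_simps)
    moreover have "A / (\<i> * h) * (B * (1 / D)) = A * B / (\<i> * (h * D))" for A B h D :: complex
      by simp
    ultimately show ?thesis
      unfolding w_def of_real_mult[of "pi / 2" "1 + t\<^sup>2"] of_real_divide[of 1] of_real_1 by metis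
  qed
  ultimately have eq: "fresnel_sq_remainder x = cis (pi / 2 * x\<^sup>2) / (\<i> * of_real (pi / 2)) *
      (V 1 * w 1 - V 0 * w 0 - integral {0..1} (\<lambda>t. V t * w' t))"
    unfolding fresnel_sq_remainder_def by (simp add: integral_unique)
  have "cmod (integral {0..1} (\<lambda>t. V t * w' t)) \<le> (2 / x * 2) * (1 - 0)"
  proof (rule integral_bound[OF zero_le_one])
    show "cmod (V t * w' t) \<le> 2 / x * 2" if "t \<in> {0..1}" for t
      unfolding norm_mult using Vb wb[OF that] x by (intro mult_mono) auto
  qed (intro continuous_intros cV cw)
  moreover have "cmod (V 1 * w 1) \<le> 1 / x"
    using Vb[of 1] by (simp add: w_def norm_mult norm_divide)
  moreover have "V 0 = 0" by (simp add: V_def)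
  ultimately have "cmod (V 1 * w 1 - V 0 * w 0 - integral {0..1} (\<lambda>t. V t * w' t)) \<le> 5 / x"
    using norm_triangle_ineq4[of "V 1 * w 1" "integral {0..1} (\<lambda>t. V t * w' t)"] by simp
  moreover have "cmod (cis (pi / 2 * x\<^sup>2) / (\<i> * of_real (pi / 2))) \<le> 1"
    using pi_gt3 by (simp add: norm_mult norm_divide)
  ultimately show ?thesis
    unfolding eq norm_mult using mult_mono[of "cmod (cis (pi / 2 * x\<^sup>2) / (\<i> * of_real (pi / 2)))" 1] by fastforce
qed

lemma fresnel_tendsto: "(fresnel \<longlongrightarrow> (1 + \<i>) / 2) at_top"
proof -
  have ev: "eventually (\<lambda>x. cmod (fresnel x - (1 + \<i>) / 2) \<le> 20 / x) at_top"
    using eventually_ge_at_top[of 1]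
  proof eventually_elim
    case (elim x)
    have "((1 + \<i>) / 2)\<^sup>2 = \<i> / 2" by (simp add: power2_eq_square field_simps)
    then have "(fresnel x - (1 + \<i>) / 2) * (fresnel x + (1 + \<i>) / 2) = fresnel_sq_remainder x"
      using fresnel_sq[of x] by (simp add: power2_eq_square algebra_simps)
    then have "cmod (fresnel x - (1 + \<i>) / 2) * cmod (fresnel x + (1 + \<i>) / 2) \<le> 5 / x"
      using fresnel_sq_remainder_bound[of x] elim by (simp add: norm_mult[symmetric])
    moreover have "1 / 4 \<le> cmod (fresnel x + (1 + \<i>) / 2)"
      using FresnelC_ge[OF elim] complex_Re_le_cmod[of "fresnel x + (1 + \<i>) / 2"] by (simp add: fresnel_def)
    then have "cmod (fresnel x - (1 + \<i>) / 2) * (1 / 4) \<le> cmod (fresnel x - (1 + \<i>) / 2) * cmod (fresnel x + (1 + \<i>) / 2)"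
      by (intro mult_left_mono) auto
    ultimately show ?case by simp
  qed
  have "((\<lambda>x::real. 20 / x) \<longlongrightarrow> 0) at_top"
    by (intro tendsto_divide_0[OF tendsto_const] filterlim_at_top_imp_at_infinity filterlim_ident)
  from Lim_null_comparison[OF ev this] show ?thesis by (simp add: LIM_zero_iff)
qed

lemma theta_tilde_bounded: "cmod (theta_tilde y) \<le> 3"
proof -
  have "cmod ((1 - \<i>) / 2) \<le> 1"
    using norm_triangle_ineq4[of 1 "\<i>"] by (simp add: norm_divide)
  then have "cmod ((1 - \<i>) / 2 * fresnel (- y / sqrt pi)) \<le> 1 * 2"
    unfolding norm_mult by (intro mult_mono fresnel_bounded) auto
  then show ?thesis
    using norm_triangle_ineq4[of "1/2" "(1 - \<i>) / 2 * fresnel (- y / sqrt pi)"] by (simp add: theta_tilde_fresnel)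
qed

lemma continuous_theta_tilde: "continuous_on S theta_tilde"
  unfolding theta_tilde_fresnel[abs_def]
  by (intro continuous_intros continuous_on_compose2[OF continuous_fresnel[of UNIV]]) auto

lemma borel_measurable_theta_tilde [measurable]: "theta_tilde \<in> borel_measurable borel"
  by (rule borel_measurable_continuous_onI[OF continuous_theta_tilde])

lemma theta_tilde_at_bot: "(theta_tilde \<longlongrightarrow> 0) at_bot"
proof -
  have "filterlim (\<lambda>y. (- y) * (1 / sqrt pi)) at_top at_bot"
    by (intro filterlim_at_top_mult_tendsto_pos[OF tendsto_const] filterlim_uminus_at_top_at_bot) auto
  then have "((\<lambda>y. fresnel (- y / sqrt pi)) \<longlongrightarrow> (1 + \<i>) / 2) at_bot"
    using filterlim_compose[OF fresnel_tendsto] by simp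
  then have "((\<lambda>y. 1/2 - (1 - \<i>) / 2 * fresnel (- y / sqrt pi)) \<longlongrightarrow> 1/2 - (1 - \<i>) / 2 * ((1 + \<i>) / 2)) at_bot"
    by (intro tendsto_intros)
  also have "1/2 - (1 - \<i>) / 2 * ((1 + \<i>) / 2) = (0::complex)"
    by (simp add: field_simps)
  finally show ?thesis by (simp add: theta_tilde_fresnel[abs_def])
qed

section \<open>Fresnel propagation of compactly supported functions\<close>

definition fresnel_kernel :: "real \<Rightarrow> real \<Rightarrow> complex" where
  "fresnel_kernel f z = of_real (sqrt (f / (2 * pi))) * cis (- pi / 4) * cis (f * z\<^sup>2 / 2)"

definition fresnel_kernel_on :: "real \<Rightarrow> real set \<Rightarrow> real \<Rightarrow> complex" where
  "fresnel_kernel_on f A z = (if z \<in> A then fresnel_kernel f z else 0)"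

lemma borel_measurable_fresnel_kernel [measurable]: "fresnel_kernel f \<in> borel_measurable borel"
  unfolding fresnel_kernel_def[abs_def] by measurable

lemma borel_measurable_fresnel_kernel_on [measurable]:
  assumes [measurable]: "A \<in> sets borel"
  shows "fresnel_kernel_on f A \<in> borel_measurable borel"
  unfolding fresnel_kernel_on_def[abs_def] by measurable

lemma fresnel_kernel_on_bounded:
  assumes "f > 0" shows "cmod (fresnel_kernel_on f A z) \<le> sqrt (f / (2 * pi))"
  using assms by (auto simp: fresnel_kernel_on_def fresnel_kernel_def norm_mult)

lemma fourier_fresnel_kernel_on:
  assumes f: "f > 0" and ab: "a \<le> b"
  shows "integrable lborel (fresnel_kernel_on f {a<..b})"
    and "complex_of_real (sqrt (2 * pi)) * fourier (fresnel_kernel_on f {a<..b}) \<xi> =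
      multiplier f \<xi> * (theta_tilde (\<xi> / sqrt f - a * sqrt f) - theta_tilde (\<xi> / sqrt f - b * sqrt f))"
proof -
  show "integrable lborel (fresnel_kernel_on f {a<..b})"
    by (rule integrable_bounded_support[OF _ fresnel_kernel_on_bounded[OF f], where a = a and b = b])
       (auto simp: fresnel_kernel_on_def)
  define s where "s = sqrt (f / pi)"
  have s2: "s\<^sup>2 = f / pi" using f by (simp add: s_def)
  define F where "F = (\<lambda>z. multiplier f \<xi> * ((1 - \<i>) / 2) * fresnel (s * z + (- s * \<xi> / f)))"
  have cis_quarter: "of_real (sqrt (f / (2 * pi))) * cis (- pi / 4) = (1 - \<i>) / 2 * of_real s"
  proof -
    have "sqrt (f / (2 * pi)) * (sqrt 2 / 2) = s / 2"
      unfolding s_def by (simp add: real_sqrt_divide real_sqrt_mult field_simps)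
    then show ?thesis by (simp add: complex_eq_iff cos_45 sin_45)
  qed
  have F: "(F has_vector_derivative cis (- \<xi> * z) * fresnel_kernel f z) (at z within S)" for z S
    unfolding F_def
  proof (rule has_vector_derivative_eq_rhs[OF has_vector_derivative_mult_right[OF fresnel_scaled_has_derivative]])
    have sq: "pi / 2 * (s * z + (- s * \<xi> / f))\<^sup>2 = f * z\<^sup>2 / 2 - \<xi> * z + \<xi>\<^sup>2 / (2 * f)"
    proof -
      have "s * z + (- s * \<xi> / f) = s * (z - \<xi> / f)" by (simp add: algebra_simps)
      then have X: "(s * z + (- s * \<xi> / f))\<^sup>2 = f / pi * (z - \<xi> / f)\<^sup>2" by (simp add: power_mult_distrib s2)
      show ?thesis unfolding X using f by (simp add: field_simps power2_eq_square)
    qed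
    have "multiplier f \<xi> * cis (pi / 2 * (s * z + (- s * \<xi> / f))\<^sup>2) = cis (- \<xi> * z) * cis (f * z\<^sup>2 / 2)"
      unfolding sq multiplier_def cis_mult by (rule arg_cong[of _ _ cis]) simp
    note phase = this
    have "A * B * (C * D) = E * (B * C * K)" if "A * D = E * K" for A B C D E K :: complex
    proof -
      have "A * B * (C * D) = (A * D) * (B * C)" by (simp only: mult_ac)
      then show ?thesis unfolding that by (simp only: mult_ac)
    qed
    from this[OF phase]
    show "multiplier f \<xi> * ((1 - \<i>) / 2) * (of_real s * cis (pi / 2 * (s * z + (- s * \<xi> / f))\<^sup>2)) = cis (- \<xi> * z) * fresnel_kernel f z"
      unfolding fresnel_kernel_def cis_quarter .
  qed
  have "(LINT z|lborel. cis (- \<xi> * z) * fresnel_kernel_on f {a<..b} z)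
      = (LINT z|lborel. indicator {a..b} z *\<^sub>R (cis (- \<xi> * z) * fresnel_kernel f z))"
  proof (rule integral_cong_AE)
    show "AE z in lborel. cis (- \<xi> * z) * fresnel_kernel_on f {a<..b} z = indicator {a..b} z *\<^sub>R (cis (- \<xi> * z) * fresnel_kernel f z)"
      using AE_lborel_singleton[of a]
      by eventually_elim (auto simp: fresnel_kernel_on_def split: split_indicator)
  qed measurable
  also have "\<dots> = F b - F a"
    by (rule integral_FTC_atLeastAtMost[OF ab F])
       (auto simp: fresnel_kernel_def intro!: continuous_intros)
  also have "\<dots> = multiplier f \<xi> * (theta_tilde (\<xi> / sqrt f - a * sqrt f) - theta_tilde (\<xi> / sqrt f - b * sqrt f))"
  proof -
    have "- (\<xi> / sqrt f - c * sqrt f) / sqrt pi = s * c + (- s * \<xi> / f)" for c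
    proof -
      define r p where "r = sqrt f" and "p = sqrt pi"
      have rp: "r > 0" "p > 0" "f = r * r" "s = r / p"
        using f by (simp_all add: r_def p_def s_def real_sqrt_divide)
      have "- (\<xi> / r - c * r) / p = r / p * c + (- (r / p) * \<xi> / (r * r))"
        using rp(1,2) by (simp add: field_simps)
      then show ?thesis unfolding r_def[symmetric] p_def[symmetric] rp(4)
        by (simp only: rp(3)[symmetric])
    qed
    then have "F c = multiplier f \<xi> * (1 / 2 - theta_tilde (\<xi> / sqrt f - c * sqrt f))" for c
      by (simp only: F_def theta_tilde_fresnel mult.assoc) simp
    then show ?thesis by (simp only: right_diff_distrib) simp
  qed
  finally have *: "(LINT z|lborel. cis (- \<xi> * z) * fresnel_kernel_on f {a<..b} z) =
    multiplier f \<xi> * (theta_tilde (\<xi> / sqrt f - a * sqrt f) - theta_tilde (\<xi> / sqrt f - b * sqrt f))" .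
  have "complex_of_real (sqrt (2 * pi)) * complex_of_real (1 / sqrt (2 * pi)) = 1"
    by (simp add: of_real_mult[symmetric] del: of_real_mult)
  then show "complex_of_real (sqrt (2 * pi)) * fourier (fresnel_kernel_on f {a<..b}) \<xi> =
      multiplier f \<xi> * (theta_tilde (\<xi> / sqrt f - a * sqrt f) - theta_tilde (\<xi> / sqrt f - b * sqrt f))"
    unfolding fourier_def * by (simp only: mult.assoc[symmetric] mult_1_left)
qed

lemma cmod_multiplier [simp]: "cmod (multiplier f \<xi>) = 1"
  by (simp add: multiplier_def)

lemma borel_measurable_multiplier [measurable]: "multiplier f \<in> borel_measurable borel"
  unfolding multiplier_def[abs_def] by measurable

locale fresnel_propagation =
  fixes f :: real and \<phi> :: "real \<Rightarrow> complex"
  assumes f_pos: "f > 0" and L2: "is_L2 \<phi>" and supp: "\<And>x. x \<notin> {-1/2..1/2} \<Longrightarrow> \<phi> x = 0"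
begin

lemma integrable_phi: "integrable lborel \<phi>"
  by (rule is_L2_imp_integrable_bounded_support[OF L2 supp])

lemma measurable_phi [measurable]: "\<phi> \<in> borel_measurable borel"
  using L2 by (simp add: is_L2_def)

lemma L2_fourier: "is_L2 (fourier \<phi>)"
  by (rule plancherel(1)[OF L2 integrable_phi])

text \<open>Up to the factor \<open>multiplier f\<close>, the Fourier multiplier of convolution with the kernel cut off to \<open>(a, b]\<close>.\<close>
definition window :: "real \<Rightarrow> real \<Rightarrow> real \<Rightarrow> complex" where
  "window a b \<xi> = theta_tilde (\<xi> / sqrt f - a * sqrt f) - theta_tilde (\<xi> / sqrt f - b * sqrt f)"

lemma measurable_window [measurable]: "window a b \<in> borel_measurable borel"
  unfolding window_def[abs_def] by measurable

lemma window_bounded: "cmod (window a b \<xi>) \<le> 6"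
  unfolding window_def
  using norm_triangle_ineq4[of "theta_tilde (\<xi> / sqrt f - a * sqrt f)" "theta_tilde (\<xi> / sqrt f - b * sqrt f)"]
    theta_tilde_bounded[of "\<xi> / sqrt f - a * sqrt f"] theta_tilde_bounded[of "\<xi> / sqrt f - b * sqrt f"] by linarith

lemma integrable_kernel_mult:
  assumes [measurable]: "A \<in> sets borel"
  shows "integrable lborel (\<lambda>y. fresnel_kernel_on f A (x - y) * \<phi> y)"
proof (rule Bochner_Integration.integrable_bound)
  show "integrable lborel (\<lambda>y. of_real (sqrt (f / (2 * pi))) * \<phi> y)" using integrable_phi by simp
  show "AE y in lborel. norm (fresnel_kernel_on f A (x - y) * \<phi> y) \<le> norm (of_real (sqrt (f / (2 * pi))) * \<phi> y)"
    using f_pos fresnel_kernel_on_bounded[OF f_pos]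
    by (auto intro!: AE_I2 mult_right_mono simp: norm_mult)
qed measurable

lemma
  assumes ab: "a \<le> b"
  shows integrable_convol_kernel: "integrable lborel (convol (fresnel_kernel_on f {a<..b}) \<phi>)"
    and L2_convol_kernel: "is_L2 (convol (fresnel_kernel_on f {a<..b}) \<phi>)"
    and fourier_convol_kernel: "fourier (convol (fresnel_kernel_on f {a<..b}) \<phi>) \<xi> = multiplier f \<xi> * window a b \<xi> * fourier \<phi> \<xi>"
proof -
  note k = fourier_fresnel_kernel_on[OF f_pos ab]
  show int: "integrable lborel (convol (fresnel_kernel_on f {a<..b}) \<phi>)"
    by (rule integrable_convol[OF k(1) integrable_phi])
  show "fourier (convol (fresnel_kernel_on f {a<..b}) \<phi>) \<xi> = multiplier f \<xi> * window a b \<xi> * fourier \<phi> \<xi>"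
    unfolding fourier_convol[OF k(1) integrable_phi] k(2) window_def by simp
  show "is_L2 (convol (fresnel_kernel_on f {a<..b}) \<phi>)"
  proof (rule is_L2_bounded_support)
    show "cmod (convol (fresnel_kernel_on f {a<..b}) \<phi> x) \<le> (LINT y|lborel. sqrt (f / (2 * pi)) * cmod (\<phi> y))" for x
      unfolding convol_def
    proof (rule order_trans[OF integral_norm_bound integral_mono])
      show "integrable lborel (\<lambda>y. cmod (fresnel_kernel_on f {a<..b} (x - y) * \<phi> y))"
        by (intro integrable_norm integrable_kernel_mult) simp
      show "integrable lborel (\<lambda>y. sqrt (f / (2 * pi)) * cmod (\<phi> y))" using integrable_phi by simp
      show "cmod (fresnel_kernel_on f {a<..b} (x - y) * \<phi> y) \<le> sqrt (f / (2 * pi)) * cmod (\<phi> y)" for y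
        unfolding norm_mult by (intro mult_right_mono fresnel_kernel_on_bounded f_pos) simp
    qed
    show "convol (fresnel_kernel_on f {a<..b}) \<phi> x = 0" if x: "x \<notin> {a - 1/2..b + 1/2}" for x
    proof -
      have "fresnel_kernel_on f {a<..b} (x - y) * \<phi> y = 0" for y
        using x supp[of y] by (cases "y \<in> {-1/2..1/2}") (auto simp: fresnel_kernel_on_def)
      then show ?thesis by (simp only: convol_def integral_zero)
    qed
  qed (use int in \<open>auto dest: borel_measurable_integrable\<close>)
qed

lemma norm_convol_kernel:
  assumes "a \<le> b"
  shows "(LINT x|lborel. (cmod (convol (fresnel_kernel_on f {a<..b}) \<phi> x))\<^sup>2) =
    (LINT \<xi>|lborel. (cmod (window a b \<xi>))\<^sup>2 * (cmod (fourier \<phi> \<xi>))\<^sup>2)"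
  unfolding plancherel(2)[OF L2_convol_kernel[OF assms] integrable_convol_kernel[OF assms], symmetric]
    fourier_convol_kernel[OF assms]
  by (simp add: norm_mult power_mult_distrib)

lemma theta_tilde_far:
  assumes "filterlim X at_top sequentially"
  shows "(\<lambda>n. theta_tilde (\<xi> / sqrt f - X n * sqrt f)) \<longlonglongrightarrow> 0"
proof -
  have "filterlim (\<lambda>n. X n * sqrt f) at_top sequentially"
    using f_pos by (intro filterlim_at_top_mult_tendsto_pos[OF tendsto_const _ assms]) auto
  then have "filterlim (\<lambda>n. - \<xi> / sqrt f + X n * sqrt f) at_top sequentially"
    by (rule filterlim_tendsto_add_at_top[OF tendsto_const])
  then have "filterlim (\<lambda>n. \<xi> / sqrt f - X n * sqrt f) at_bot sequentially"
    by (subst filterlim_uminus_at_bot) (simp add: algebra_simps)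
  then show ?thesis by (rule filterlim_compose[OF theta_tilde_at_bot])
qed

lemma tendsto_window_upper: "(\<lambda>n. window a (real n) \<xi>) \<longlonglongrightarrow> theta_tilde (\<xi> / sqrt f - a * sqrt f)"
  unfolding window_def using tendsto_diff[OF tendsto_const theta_tilde_far[OF filterlim_real_sequentially]] by simp

lemma tendsto_window_both: "(\<lambda>n. window (- real n) (real n) \<xi>) \<longlonglongrightarrow> 1"
proof -
  have "theta_tilde (\<xi> / sqrt f - (- real n) * sqrt f) = 1 - theta_tilde ((- \<xi>) / sqrt f - real n * sqrt f)" for n
    using theta_tilde_minus[of "(- \<xi>) / sqrt f - real n * sqrt f"] by (simp add: add.commute)
  moreover have "(\<lambda>n. 1 - theta_tilde ((- \<xi>) / sqrt f - real n * sqrt f) - theta_tilde (\<xi> / sqrt f - real n * sqrt f)) \<longlonglongrightarrow> 1 - 0 - 0"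
    by (intro tendsto_intros theta_tilde_far filterlim_real_sequentially)
  ultimately show ?thesis by (simp add: window_def)
qed

lemma far_field:
  assumes a: "a \<le> 1"
  shows "is_L2 (convol (fresnel_kernel_on f {a<..}) \<phi>)"
    and "(LINT x|lborel. (cmod (convol (fresnel_kernel_on f {a<..}) \<phi> x))\<^sup>2) \<le>
      (LINT \<xi>|lborel. (cmod (theta_tilde (\<xi> / sqrt f - a * sqrt f)))\<^sup>2 * (cmod (fourier \<phi> \<xi>))\<^sup>2)"
proof -
  let ?u = "\<lambda>n::nat. convol (fresnel_kernel_on f {a<..real (Suc n)}) \<phi>"
  have le: "a \<le> real (Suc n)" for n using a by simp
  have u: "is_L2 (?u n)" for n by (rule L2_convol_kernel[OF le])
  have lim: "(\<lambda>n. ?u n x) \<longlonglongrightarrow> convol (fresnel_kernel_on f {a<..}) \<phi> x" for x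
  proof -
    obtain N :: nat where N: "\<bar>x\<bar> + 1 \<le> N" using real_arch_simple by blast
    have "eventually (\<lambda>n. ?u n x = convol (fresnel_kernel_on f {a<..}) \<phi> x) sequentially"
      using eventually_ge_at_top[of N]
    proof eventually_elim
      case (elim n)
      have "fresnel_kernel_on f {a<..real (Suc n)} (x - y) * \<phi> y = fresnel_kernel_on f {a<..} (x - y) * \<phi> y" for y
        using N of_nat_mono[OF elim, where ?'a = real] supp[of y] by (cases "y \<in> {-1/2..1/2}") (auto simp: fresnel_kernel_on_def)
      then show ?case by (simp only: convol_def)
    qed
    then show ?thesis by (rule tendsto_eventually)
  qed
  have "(\<lambda>n. LINT \<xi>|lborel. (cmod (window a (real (Suc n)) \<xi>))\<^sup>2 * (cmod (fourier \<phi> \<xi>))\<^sup>2)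
    \<longlonglongrightarrow> (LINT \<xi>|lborel. (cmod (theta_tilde (\<xi> / sqrt f - a * sqrt f)))\<^sup>2 * (cmod (fourier \<phi> \<xi>))\<^sup>2)"
  proof (rule integral_dominated_convergence[where w = "\<lambda>\<xi>. 6\<^sup>2 * (cmod (fourier \<phi> \<xi>))\<^sup>2"])
    show "AE \<xi> in lborel. (\<lambda>n. (cmod (window a (real (Suc n)) \<xi>))\<^sup>2 * (cmod (fourier \<phi> \<xi>))\<^sup>2)
      \<longlonglongrightarrow> (cmod (theta_tilde (\<xi> / sqrt f - a * sqrt f)))\<^sup>2 * (cmod (fourier \<phi> \<xi>))\<^sup>2"
      by (intro AE_I2 tendsto_intros LIMSEQ_Suc[OF tendsto_window_upper])
    show "AE \<xi> in lborel. norm ((cmod (window a (real (Suc n)) \<xi>))\<^sup>2 * (cmod (fourier \<phi> \<xi>))\<^sup>2) \<le> 6\<^sup>2 * (cmod (fourier \<phi> \<xi>))\<^sup>2" for n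
      unfolding real_norm_def abs_mult abs_power2
      by (intro AE_I2 mult_right_mono power_mono window_bounded) auto
  qed (use is_L2_D(3)[OF L2_fourier] in auto)
  then have L: "(\<lambda>n. LINT x|lborel. (cmod (?u n x))\<^sup>2)
    \<longlonglongrightarrow> (LINT \<xi>|lborel. (cmod (theta_tilde (\<xi> / sqrt f - a * sqrt f)))\<^sup>2 * (cmod (fourier \<phi> \<xi>))\<^sup>2)"
    unfolding norm_convol_kernel[OF le] .
  show "is_L2 (convol (fresnel_kernel_on f {a<..}) \<phi>)"
    by (rule L2_Fatou(1)[OF u lim L])
  show "(LINT x|lborel. (cmod (convol (fresnel_kernel_on f {a<..}) \<phi> x))\<^sup>2) \<le>
      (LINT \<xi>|lborel. (cmod (theta_tilde (\<xi> / sqrt f - a * sqrt f)))\<^sup>2 * (cmod (fourier \<phi> \<xi>))\<^sup>2)"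
    by (rule L2_Fatou(2)[OF u lim L])
qed

definition spectrum :: "real \<Rightarrow> complex" where
  "spectrum \<xi> = multiplier f \<xi> * fourier \<phi> \<xi>"

lemma L2_spectrum: "is_L2 spectrum"
  unfolding spectrum_def[abs_def] by (rule is_L2_mult_bounded[OF L2_fourier, where M = 1]) auto

lemma measurable_spectrum [measurable]: "spectrum \<in> borel_measurable borel"
  using L2_spectrum by (simp add: is_L2_def)

definition spectrum_trunc :: "real \<Rightarrow> real \<Rightarrow> complex" where
  "spectrum_trunc R \<xi> = (if \<xi> \<in> {-R..R} then spectrum \<xi> else 0)"

lemma measurable_spectrum_trunc [measurable]: "spectrum_trunc R \<in> borel_measurable borel"
  unfolding spectrum_trunc_def[abs_def] by measurable

lemma L2_spectrum_trunc: "is_L2 (spectrum_trunc R)"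
  by (rule is_L2_bound[OF _ is_L2_D(3)[OF L2_spectrum]]) (auto simp: spectrum_trunc_def)

lemma integrable_spectrum_trunc: "integrable lborel (spectrum_trunc R)"
  by (rule is_L2_imp_integrable_bounded_support[OF L2_spectrum_trunc, where a = "-R" and b = R])
     (auto simp: spectrum_trunc_def)

lemma fourier_inv_trunc_eq: "fourier_inv_trunc R spectrum x = fourier (spectrum_trunc R) (- x)"
  unfolding fourier_inv_trunc_def fourier_def set_lebesgue_integral_def
  by (intro arg_cong2[where f = "(*)"] refl Bochner_Integration.integral_cong)
     (auto simp: spectrum_trunc_def mult.commute split: split_indicator)

lemma L2_fourier_inv_trunc: "is_L2 (fourier_inv_trunc R spectrum)"
  unfolding fourier_inv_trunc_eq[abs_def]
  by (rule plancherel_inverse(1)[OF L2_spectrum_trunc integrable_spectrum_trunc L2 integrable_phi])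

lemma trunc_minus_convol_kernel:
  "(LINT x|lborel. (cmod (fourier_inv_trunc R spectrum x - convol (fresnel_kernel_on f {- real n<..real n}) \<phi> x))\<^sup>2)
   = (LINT \<xi>|lborel. (cmod (spectrum_trunc R \<xi> - window (- real n) (real n) \<xi> * spectrum \<xi>))\<^sup>2)"
proof -
  have le: "- real n \<le> real n" by simp
  show ?thesis
    unfolding fourier_inv_trunc_eq
      plancherel_inverse(2)[OF L2_spectrum_trunc integrable_spectrum_trunc L2_convol_kernel[OF le] integrable_convol_kernel[OF le]]
      fourier_convol_kernel[OF le] spectrum_def by (simp add: mult_ac)
qed

lemma convol_kernel_tendsto:
  "(\<lambda>n. convol (fresnel_kernel_on f {- real n<..real n}) \<phi> x) \<longlonglongrightarrow> convol (fresnel_kernel f) \<phi> x"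
proof -
  obtain N :: nat where N: "\<bar>x\<bar> + 1 \<le> N" using real_arch_simple by blast
  have "eventually (\<lambda>n. convol (fresnel_kernel_on f {- real n<..real n}) \<phi> x = convol (fresnel_kernel f) \<phi> x) sequentially"
    using eventually_ge_at_top[of N]
  proof eventually_elim
    case (elim n)
    have "fresnel_kernel_on f {- real n<..real n} (x - y) * \<phi> y = fresnel_kernel f (x - y) * \<phi> y" for y
      using N of_nat_mono[OF elim, where ?'a = real] supp[of y] by (cases "y \<in> {-1/2..1/2}") (auto simp: fresnel_kernel_on_def)
    then show ?case by (simp only: convol_def)
  qed
  then show ?thesis by (rule tendsto_eventually)
qed

lemma trunc_minus_convol:
  shows "is_L2 (\<lambda>x. fourier_inv_trunc R spectrum x - convol (fresnel_kernel f) \<phi> x)"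
    and "(LINT x|lborel. (cmod (fourier_inv_trunc R spectrum x - convol (fresnel_kernel f) \<phi> x))\<^sup>2)
      \<le> (LINT \<xi>|lborel. (cmod (spectrum_trunc R \<xi> - spectrum \<xi>))\<^sup>2)"
proof -
  have le: "- real n \<le> real n" for n by simp
  let ?u = "\<lambda>n x. fourier_inv_trunc R spectrum x - convol (fresnel_kernel_on f {- real n<..real n}) \<phi> x"
  have u: "is_L2 (?u n)" for n
    by (intro is_L2_diff L2_fourier_inv_trunc L2_convol_kernel le)
  have lim: "(\<lambda>n. ?u n x) \<longlonglongrightarrow> fourier_inv_trunc R spectrum x - convol (fresnel_kernel f) \<phi> x" for x
    by (intro tendsto_intros convol_kernel_tendsto)
  have "(\<lambda>n. LINT \<xi>|lborel. (cmod (spectrum_trunc R \<xi> - window (- real n) (real n) \<xi> * spectrum \<xi>))\<^sup>2)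
    \<longlonglongrightarrow> (LINT \<xi>|lborel. (cmod (spectrum_trunc R \<xi> - 1 * spectrum \<xi>))\<^sup>2)"
  proof (rule integral_dominated_convergence[where w = "\<lambda>\<xi>. 7\<^sup>2 * (cmod (spectrum \<xi>))\<^sup>2"])
    show "AE \<xi> in lborel. (\<lambda>n. (cmod (spectrum_trunc R \<xi> - window (- real n) (real n) \<xi> * spectrum \<xi>))\<^sup>2)
       \<longlonglongrightarrow> (cmod (spectrum_trunc R \<xi> - 1 * spectrum \<xi>))\<^sup>2"
      by (intro AE_I2 tendsto_intros tendsto_window_both)
    show "AE \<xi> in lborel. norm ((cmod (spectrum_trunc R \<xi> - window (- real n) (real n) \<xi> * spectrum \<xi>))\<^sup>2) \<le> 7\<^sup>2 * (cmod (spectrum \<xi>))\<^sup>2" for n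
    proof (rule AE_I2)
      fix \<xi>
      have "cmod (window (- real n) (real n) \<xi> * spectrum \<xi>) \<le> 6 * cmod (spectrum \<xi>)"
        unfolding norm_mult by (intro mult_right_mono window_bounded) auto
      moreover have "cmod (spectrum_trunc R \<xi>) \<le> cmod (spectrum \<xi>)" by (simp add: spectrum_trunc_def)
      ultimately have "cmod (spectrum_trunc R \<xi> - window (- real n) (real n) \<xi> * spectrum \<xi>) \<le> 7 * cmod (spectrum \<xi>)"
        using norm_triangle_ineq4[of "spectrum_trunc R \<xi>" "window (- real n) (real n) \<xi> * spectrum \<xi>"] by linarith
      then have "(cmod (spectrum_trunc R \<xi> - window (- real n) (real n) \<xi> * spectrum \<xi>))\<^sup>2 \<le> (7 * cmod (spectrum \<xi>))\<^sup>2"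
        by (intro power_mono) auto
      then show "norm ((cmod (spectrum_trunc R \<xi> - window (- real n) (real n) \<xi> * spectrum \<xi>))\<^sup>2) \<le> 7\<^sup>2 * (cmod (spectrum \<xi>))\<^sup>2"
        by (simp add: power_mult_distrib)
    qed
  qed (use is_L2_D(3)[OF L2_spectrum] in auto)
  then have L: "(\<lambda>n. LINT x|lborel. (cmod (?u n x))\<^sup>2) \<longlonglongrightarrow> (LINT \<xi>|lborel. (cmod (spectrum_trunc R \<xi> - spectrum \<xi>))\<^sup>2)"
    unfolding trunc_minus_convol_kernel by simp
  show "is_L2 (\<lambda>x. fourier_inv_trunc R spectrum x - convol (fresnel_kernel f) \<phi> x)"
    by (rule L2_Fatou(1)[OF u lim L])
  show "(LINT x|lborel. (cmod (fourier_inv_trunc R spectrum x - convol (fresnel_kernel f) \<phi> x))\<^sup>2)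
      \<le> (LINT \<xi>|lborel. (cmod (spectrum_trunc R \<xi> - spectrum \<xi>))\<^sup>2)"
    by (rule L2_Fatou(2)[OF u lim L])
qed

lemma L2_convol_fresnel_kernel: "is_L2 (convol (fresnel_kernel f) \<phi>)"
  using is_L2_diff[OF L2_fourier_inv_trunc[of 0] trunc_minus_convol(1)[of 0]] by simp

lemma trunc_tendsto_convol:
  "((\<lambda>R. LINT x|lborel. (cmod (convol (fresnel_kernel f) \<phi> x - fourier_inv_trunc R spectrum x))\<^sup>2) \<longlongrightarrow> 0) at_top"
proof (rule tendsto_sandwich[OF _ _ tendsto_const])
  show "eventually (\<lambda>R. (LINT x|lborel. (cmod (convol (fresnel_kernel f) \<phi> x - fourier_inv_trunc R spectrum x))\<^sup>2)
     \<le> (LINT \<xi>|lborel. (cmod (spectrum_trunc R \<xi> - spectrum \<xi>))\<^sup>2)) at_top"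
    by (rule always_eventually) (use trunc_minus_convol(2) in \<open>simp add: norm_minus_commute\<close>)
  have "((\<lambda>R. LINT \<xi>|lborel. (cmod (spectrum_trunc R \<xi> - spectrum \<xi>))\<^sup>2) \<longlongrightarrow> (LINT (\<xi>::real)|lborel. 0)) at_top"
  proof (rule integral_dominated_convergence_at_top[where w = "\<lambda>\<xi>. (cmod (spectrum \<xi>))\<^sup>2"])
    show "AE \<xi> in lborel. ((\<lambda>R. (cmod (spectrum_trunc R \<xi> - spectrum \<xi>))\<^sup>2) \<longlongrightarrow> 0) at_top"
    proof (rule AE_I2)
      fix \<xi>
      have "eventually (\<lambda>R. (cmod (spectrum_trunc R \<xi> - spectrum \<xi>))\<^sup>2 = 0) at_top"
        using eventually_ge_at_top[of "\<bar>\<xi>\<bar>"] by eventually_elim (auto simp: spectrum_trunc_def)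
      then show "((\<lambda>R. (cmod (spectrum_trunc R \<xi> - spectrum \<xi>))\<^sup>2) \<longlongrightarrow> 0) at_top" by (rule tendsto_eventually)
    qed
    show "\<forall>\<^sub>F R in at_top. AE \<xi> in lborel. norm ((cmod (spectrum_trunc R \<xi> - spectrum \<xi>))\<^sup>2) \<le> (cmod (spectrum \<xi>))\<^sup>2"
      by (intro always_eventually allI AE_I2) (auto simp: spectrum_trunc_def)
  qed (use is_L2_D(3)[OF L2_spectrum] in auto)
  then show "((\<lambda>R. LINT \<xi>|lborel. (cmod (spectrum_trunc R \<xi> - spectrum \<xi>))\<^sup>2) \<longlongrightarrow> 0) at_top" by simp
qed auto

lemma fresnel_D_L2_limit:
  "is_L2 (fresnel_D f \<phi>) \<and>
    ((\<lambda>R. LINT x|lborel. (cmod (fresnel_D f \<phi> x - fourier_inv_trunc R spectrum x))\<^sup>2) \<longlongrightarrow> 0) at_top"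
  unfolding fresnel_D_def fourier_inv_L2_def spectrum_def[symmetric]
  by (rule someI[of _ "convol (fresnel_kernel f) \<phi>"])
     (intro conjI L2_convol_fresnel_kernel trunc_tendsto_convol)

lemma L2_fresnel_D: "is_L2 (fresnel_D f \<phi>)"
  using fresnel_D_L2_limit ..

theorem fresnel_D_eq_convol: "AE x in lborel. fresnel_D f \<phi> x = convol (fresnel_kernel f) \<phi> x"
proof -
  let ?h = "fresnel_D f \<phi>" and ?k = "convol (fresnel_kernel f) \<phi>"
  note h = fresnel_D_L2_limit and hL2 = L2_fresnel_D
  note d = is_L2_diff[OF hL2 L2_convol_fresnel_kernel]
  have "(LINT x|lborel. (cmod (?h x - ?k x))\<^sup>2) \<le> 0"
  proof (rule tendsto_lowerbound)
    show "((\<lambda>R. 2 * (LINT x|lborel. (cmod (?h x - fourier_inv_trunc R spectrum x))\<^sup>2)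
        + 2 * (LINT x|lborel. (cmod (?k x - fourier_inv_trunc R spectrum x))\<^sup>2)) \<longlongrightarrow> 0) at_top"
      using tendsto_add[OF tendsto_mult[OF tendsto_const conjunct2[OF h], of 2] tendsto_mult[OF tendsto_const trunc_tendsto_convol, of 2]]
      by simp
    show "\<forall>\<^sub>F R in at_top. (LINT x|lborel. (cmod (?h x - ?k x))\<^sup>2) \<le>
        2 * (LINT x|lborel. (cmod (?h x - fourier_inv_trunc R spectrum x))\<^sup>2)
        + 2 * (LINT x|lborel. (cmod (?k x - fourier_inv_trunc R spectrum x))\<^sup>2)"
    proof (intro always_eventually allI)
      fix R
      note i = is_L2_D(3)[OF is_L2_diff[OF hL2 L2_fourier_inv_trunc[of R]]]
        is_L2_D(3)[OF is_L2_diff[OF L2_convol_fresnel_kernel L2_fourier_inv_trunc[of R]]]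
      have "(LINT x|lborel. (cmod (?h x - ?k x))\<^sup>2) \<le> (LINT x|lborel. 2 * (cmod (?h x - fourier_inv_trunc R spectrum x))\<^sup>2
          + 2 * (cmod (?k x - fourier_inv_trunc R spectrum x))\<^sup>2)"
      proof (rule integral_mono[OF is_L2_D(3)[OF d]])
        show "(cmod (?h x - ?k x))\<^sup>2 \<le> 2 * (cmod (?h x - fourier_inv_trunc R spectrum x))\<^sup>2
          + 2 * (cmod (?k x - fourier_inv_trunc R spectrum x))\<^sup>2" for x
          using cmod_diff_sq_le_2[of "?h x - fourier_inv_trunc R spectrum x" "?k x - fourier_inv_trunc R spectrum x"] by simp
      qed (use i in auto)
      then show "(LINT x|lborel. (cmod (?h x - ?k x))\<^sup>2) \<le> 2 * (LINT x|lborel. (cmod (?h x - fourier_inv_trunc R spectrum x))\<^sup>2)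
        + 2 * (LINT x|lborel. (cmod (?k x - fourier_inv_trunc R spectrum x))\<^sup>2)"
        using i by simp
    qed
  qed simp
  then have "(LINT x|lborel. (cmod (?h x - ?k x))\<^sup>2) = 0"
    by (intro antisym) auto
  then have "AE x in lborel. (cmod (?h x - ?k x))\<^sup>2 = 0"
    using integral_nonneg_eq_0_iff_AE[OF is_L2_D(3)[OF d]] by auto
  then show "AE x in lborel. ?h x = ?k x" by simp
qed

end

section \<open>Leakage out of the unit interval\<close>

lemma borel_measurable_theta_tilde_beta [measurable]: "theta_tilde_beta \<beta> \<in> borel_measurable borel"
  unfolding theta_tilde_beta_def[abs_def] by measurable

lemma theta_tilde_beta_bounded: "cmod (theta_tilde_beta \<beta> x) \<le> 6"
  unfolding theta_tilde_beta_def
  using norm_triangle_ineq4[of "theta_tilde x" "theta_tilde (x - sqrt \<beta>)"]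
    theta_tilde_bounded[of x] theta_tilde_bounded[of "x - sqrt \<beta>"] by linarith

lemma sym_sq: "(sym p x)\<^sup>2 = ((cmod (p x))\<^sup>2 + (cmod (p (- x)))\<^sup>2) / 2"
  by (simp add: sym_def power_mult_distrib power_divide)

lemma sym_nonneg: "0 \<le> sym p x"
  by (simp add: sym_def)

lemma sym_theta_tilde_beta_le_C_sym: "sym (theta_tilde_beta \<beta>) x \<le> C_sym \<beta>"
  unfolding C_sym_def
proof (rule cSUP_upper)
  show "bdd_above (range (sym (theta_tilde_beta \<beta>)))"
  proof (rule bdd_aboveI2)
    fix x
    have b: "(cmod (theta_tilde_beta \<beta> x))\<^sup>2 \<le> 6\<^sup>2" for x
      by (intro power_mono theta_tilde_beta_bounded) auto
    have "(sym (theta_tilde_beta \<beta>) x)\<^sup>2 \<le> 6\<^sup>2"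
      unfolding sym_sq using b[of x] b[of "-x"] by simp
    then show "sym (theta_tilde_beta \<beta>) x \<le> 6"
      by (rule power2_le_imp_le) simp
  qed
qed simp

lemma C_sym_nonneg: "0 \<le> C_sym \<beta>"
  using order_trans[OF sym_nonneg sym_theta_tilde_beta_le_C_sym] .

lemma integrable_mult_fourier_sq:
  fixes b :: "real \<Rightarrow> complex"
  assumes "is_L2 g" "b \<in> borel_measurable borel" "\<And>x. cmod (b x) \<le> M"
  shows "integrable lborel (\<lambda>\<xi>. (cmod (b \<xi>))\<^sup>2 * (cmod (g \<xi>))\<^sup>2)"
  using is_L2_D(3)[OF is_L2_mult_bounded[OF assms(1) _ assms(3)]] assms(2)
  by (simp add: norm_mult power_mult_distrib)

text \<open>For real-valued data the modulus of the spectrum is even, so the multiplier may be symmetrised.\<close>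
lemma theta_tilde_beta_multiplier_bound:
  assumes g: "is_L2 g" "integrable lborel g" and real: "\<And>x. cnj (g x) = g x"
  shows "(LINT \<xi>|lborel. (cmod (theta_tilde_beta \<beta> (\<xi> / r)))\<^sup>2 * (cmod (fourier g \<xi>))\<^sup>2) \<le> (C_sym \<beta>)\<^sup>2 * (LINT x|lborel. (cmod (g x))\<^sup>2)"
    (is "?I \<le> _")
proof -
  let ?p = "\<lambda>\<xi>. (cmod (theta_tilde_beta \<beta> (\<xi> / r)))\<^sup>2"
  note Fg = plancherel(1)[OF g]
  have even: "cmod (fourier g (- \<xi>)) = cmod (fourier g \<xi>)" for \<xi>
    using fourier_cnj[of g \<xi>] by (simp add: real)
  have i1: "integrable lborel (\<lambda>\<xi>. ?p \<xi> * (cmod (fourier g \<xi>))\<^sup>2)"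
    by (rule integrable_mult_fourier_sq[OF Fg _ theta_tilde_beta_bounded]) measurable
  have i2: "integrable lborel (\<lambda>\<xi>. ?p (- \<xi>) * (cmod (fourier g \<xi>))\<^sup>2)"
    by (rule integrable_mult_fourier_sq[OF Fg _ theta_tilde_beta_bounded]) measurable
  have "?I = (LINT \<xi>|lborel. ?p (- \<xi>) * (cmod (fourier g \<xi>))\<^sup>2)"
    by (subst lborel_integral_real_affine[of "-1" _ 0]) (simp_all add: even)
  then have "2 * ?I = (LINT \<xi>|lborel. ?p \<xi> * (cmod (fourier g \<xi>))\<^sup>2 + ?p (- \<xi>) * (cmod (fourier g \<xi>))\<^sup>2)"
    using i1 i2 by simp
  also have "\<dots> \<le> (LINT \<xi>|lborel. 2 * (C_sym \<beta>)\<^sup>2 * (cmod (fourier g \<xi>))\<^sup>2)"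
  proof (rule integral_mono)
    fix \<xi>
    have "(sym (theta_tilde_beta \<beta>) (\<xi> / r))\<^sup>2 \<le> (C_sym \<beta>)\<^sup>2"
      by (intro power_mono sym_theta_tilde_beta_le_C_sym sym_nonneg)
    then have "?p \<xi> + ?p (- \<xi>) \<le> 2 * (C_sym \<beta>)\<^sup>2" unfolding sym_sq by simp
    then show "?p \<xi> * (cmod (fourier g \<xi>))\<^sup>2 + ?p (- \<xi>) * (cmod (fourier g \<xi>))\<^sup>2 \<le> 2 * (C_sym \<beta>)\<^sup>2 * (cmod (fourier g \<xi>))\<^sup>2"
      unfolding distrib_right[symmetric] by (rule mult_right_mono) simp
  qed (use i1 i2 is_L2_D(3)[OF Fg] in auto)
  also have "\<dots> = 2 * ((C_sym \<beta>)\<^sup>2 * (LINT x|lborel. (cmod (g x))\<^sup>2))"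
    unfolding plancherel(2)[OF g, symmetric] by simp
  finally show ?thesis by simp
qed

text \<open>For \<open>x > 1/2\<close> the kernel is only evaluated at positive arguments. Arguments beyond \<open>1/2\<close> give the
  far field; arguments in \<open>(0, 1/2]\<close> only see the restriction of \<open>\<phi>\<close> to the right half of its support.\<close>
lemma (in fresnel_propagation) leakage_right:
  assumes real: "\<And>x. cnj (\<phi> x) = \<phi> x" and t: "t > 0"
  shows "(LINT x|lborel. indicator {1/2<..} x * (cmod (convol (fresnel_kernel f) \<phi> x))\<^sup>2) \<le>
    (1 + t) * (LINT \<xi>|lborel. (cmod (theta_tilde (\<xi> / sqrt f - sqrt (f / 4))))\<^sup>2 * (cmod (fourier \<phi> \<xi>))\<^sup>2)
    + (1 + 1 / t) * ((C_sym (f / 4))\<^sup>2 * (LINT x|lborel. indicator {0<..} x * (cmod (\<phi> x))\<^sup>2))"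
proof -
  define \<psi> where "\<psi> = (\<lambda>y. if y > 0 then \<phi> y else 0)"
  have \<psi>L2: "is_L2 \<psi>"
    by (rule is_L2_bound[OF _ is_L2_D(3)[OF L2]]) (auto simp: \<psi>_def)
  interpret r: fresnel_propagation f \<psi>
    by unfold_locales (use f_pos \<psi>L2 supp in \<open>auto simp: \<psi>_def\<close>)
  have beta: "sqrt (f / 4) = 1 / 2 * sqrt f" by (simp add: real_sqrt_divide)
  let ?A = "convol (fresnel_kernel_on f {1/2<..}) \<phi>" and ?B = "convol (fresnel_kernel_on f {0<..1/2}) \<psi>"
  have split: "convol (fresnel_kernel f) \<phi> x = ?A x + ?B x" if x: "x > 1/2" for x
  proof -
    have "fresnel_kernel f (x - y) * \<phi> y = fresnel_kernel_on f {1/2<..} (x - y) * \<phi> y + fresnel_kernel_on f {0<..1/2} (x - y) * \<psi> y" for y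
      using x supp[of y] by (cases "y \<in> {-1/2..1/2}") (auto simp: fresnel_kernel_on_def \<psi>_def)
    then have "convol (fresnel_kernel f) \<phi> x =
      (LINT y|lborel. fresnel_kernel_on f {1/2<..} (x - y) * \<phi> y + fresnel_kernel_on f {0<..1/2} (x - y) * \<psi> y)"
      by (simp only: convol_def)
    also have "\<dots> = ?A x + ?B x"
      unfolding convol_def
      by (intro Bochner_Integration.integral_add integrable_kernel_mult r.integrable_kernel_mult) auto
    finally show ?thesis .
  qed
  have le: "0 \<le> (1/2 :: real)" "1/2 \<le> (1 :: real)" by simp_all
  have iA: "integrable lborel (\<lambda>x. (cmod (?A x))\<^sup>2)" by (rule is_L2_D(3)[OF far_field(1)[OF le(2)]])
  have iB: "integrable lborel (\<lambda>x. (cmod (?B x))\<^sup>2)" by (rule is_L2_D(3)[OF r.L2_convol_kernel[OF le(1)]])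
  have "(LINT x|lborel. indicator {1/2<..} x * (cmod (convol (fresnel_kernel f) \<phi> x))\<^sup>2)
    \<le> (LINT x|lborel. (1 + t) * (cmod (?A x))\<^sup>2 + (1 + 1 / t) * (cmod (?B x))\<^sup>2)"
  proof (rule integral_mono)
    show "integrable lborel (\<lambda>x. indicator {1/2<..} x * (cmod (convol (fresnel_kernel f) \<phi> x))\<^sup>2)"
      by (rule integrable_real_mult_indicator[OF _ is_L2_D(3)[OF L2_convol_fresnel_kernel], unfolded mult.commute[of _ "indicator _ _"]]) simp
    show "indicator {1/2<..} x * (cmod (convol (fresnel_kernel f) \<phi> x))\<^sup>2 \<le> (1 + t) * (cmod (?A x))\<^sup>2 + (1 + 1 / t) * (cmod (?B x))\<^sup>2" for x
    proof (cases "x > 1/2")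
      case True
      then show ?thesis using cmod_add_sq_le[OF t, of "?A x" "?B x"] split[OF True] by simp
    next
      case False
      then show ?thesis using t by simp
    qed
  qed (use iA iB in auto)
  also have "\<dots> = (1 + t) * (LINT x|lborel. (cmod (?A x))\<^sup>2) + (1 + 1 / t) * (LINT x|lborel. (cmod (?B x))\<^sup>2)"
    using iA iB by simp
  also have "\<dots> \<le> (1 + t) * (LINT \<xi>|lborel. (cmod (theta_tilde (\<xi> / sqrt f - sqrt (f / 4))))\<^sup>2 * (cmod (fourier \<phi> \<xi>))\<^sup>2)
    + (1 + 1 / t) * ((C_sym (f / 4))\<^sup>2 * (LINT x|lborel. indicator {0<..} x * (cmod (\<phi> x))\<^sup>2))"
  proof (intro add_mono mult_left_mono)
    show "(LINT x|lborel. (cmod (?A x))\<^sup>2) \<le> (LINT \<xi>|lborel. (cmod (theta_tilde (\<xi> / sqrt f - sqrt (f / 4))))\<^sup>2 * (cmod (fourier \<phi> \<xi>))\<^sup>2)"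
      unfolding beta by (rule far_field(2)[OF le(2)])
    have "(LINT x|lborel. (cmod (?B x))\<^sup>2) = (LINT \<xi>|lborel. (cmod (theta_tilde_beta (f / 4) (\<xi> / sqrt f)))\<^sup>2 * (cmod (fourier \<psi> \<xi>))\<^sup>2)"
      unfolding r.norm_convol_kernel[OF le(1)] r.window_def theta_tilde_beta_def beta by simp
    also have "\<dots> \<le> (C_sym (f / 4))\<^sup>2 * (LINT x|lborel. (cmod (\<psi> x))\<^sup>2)"
      by (rule theta_tilde_beta_multiplier_bound[OF \<psi>L2 r.integrable_phi]) (simp add: \<psi>_def real)
    also have "(LINT x|lborel. (cmod (\<psi> x))\<^sup>2) = (LINT x|lborel. indicator {0<..} x * (cmod (\<phi> x))\<^sup>2)"
      by (intro Bochner_Integration.integral_cong) (auto simp: \<psi>_def)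
    finally show "(LINT x|lborel. (cmod (?B x))\<^sup>2) \<le> (C_sym (f / 4))\<^sup>2 * (LINT x|lborel. indicator {0<..} x * (cmod (\<phi> x))\<^sup>2)" .
  qed (use t in auto)
  finally show ?thesis .
qed

lemma convol_fresnel_kernel_reflect:
  "convol (fresnel_kernel f) (\<lambda>y. \<phi> (- y)) x = convol (fresnel_kernel f) \<phi> (- x)"
proof -
  have "fresnel_kernel f (- x - y) = fresnel_kernel f (x + y)" for y
    by (simp add: fresnel_kernel_def power2_eq_square algebra_simps)
  then show ?thesis
    unfolding convol_def by (subst lborel_integral_real_affine[of "-1" _ 0]) simp_all
qed

lemma (in fresnel_propagation) leakage:
  assumes real: "\<And>x. cnj (\<phi> x) = \<phi> x"
  shows "L2norm (\<lambda>x. if x \<in> {-1/2..1/2} then 0 else fresnel_D f \<phi> x)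
     \<le> L2norm (\<lambda>\<xi>. complex_of_real (p_leak f (f / 4) \<xi>) * fourier \<phi> \<xi>) + C_sym (f / 4) * L2norm \<phi>"
proof -
  let ?h = "\<lambda>x. (cmod (convol (fresnel_kernel f) \<phi> x))\<^sup>2" and ?\<beta> = "f / 4"
  interpret l: fresnel_propagation f "\<lambda>y. \<phi> (- y)"
    by unfold_locales (use f_pos is_L2_affine[OF L2, of "-1" 0] supp in auto)
  define X where "X = (LINT \<xi>|lborel. (cmod (complex_of_real (p_leak f ?\<beta> \<xi>) * fourier \<phi> \<xi>))\<^sup>2)"
  define N where "N = (LINT x|lborel. (cmod (\<phi> x))\<^sup>2)"
  define Z where "Z = (LINT x|lborel. (cmod (if x \<in> {-1/2..1/2} then 0 else fresnel_D f \<phi> x))\<^sup>2)"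
  note [measurable] = is_L2_D(2)[OF L2_convol_fresnel_kernel] is_L2_D(2)[OF L2_fresnel_D]
  have ind: "integrable lborel (\<lambda>x. indicator A x * u x)" if "integrable lborel u" "A \<in> sets borel" for A and u :: "real \<Rightarrow> real"
    using integrable_real_mult_indicator[OF _ that(1), of A] that(2) by (simp add: mult.commute)
  have ih: "integrable lborel ?h" by (rule is_L2_D(3)[OF L2_convol_fresnel_kernel])
  have "Z = (LINT x|lborel. indicator {1/2<..} x * ?h x + indicator {..<-1/2} x * ?h x)"
    unfolding Z_def
  proof (rule integral_cong_AE)
    show "AE x in lborel. (cmod (if x \<in> {-1/2..1/2} then 0 else fresnel_D f \<phi> x))\<^sup>2 = indicator {1/2<..} x * ?h x + indicator {..<-1/2} x * ?h x"
      using fresnel_D_eq_convol by eventually_elim (auto split: split_indicator)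
  qed measurable
  also have "\<dots> = (LINT x|lborel. indicator {1/2<..} x * ?h x) + (LINT x|lborel. indicator {..<-1/2} x * ?h x)"
    by (intro Bochner_Integration.integral_add ind ih) auto
  also have "(LINT x|lborel. indicator {..<-1/2} x * ?h x) =
      (LINT x|lborel. indicator {1/2<..} x * (cmod (convol (fresnel_kernel f) (\<lambda>y. \<phi> (- y)) x))\<^sup>2)"
    unfolding convol_fresnel_kernel_reflect
    by (subst lborel_integral_real_affine[of "-1" _ 0]) (auto intro!: Bochner_Integration.integral_cong split: split_indicator)
  finally have Z: "Z = (LINT x|lborel. indicator {1/2<..} x * ?h x) +
      (LINT x|lborel. indicator {1/2<..} x * (cmod (convol (fresnel_kernel f) (\<lambda>y. \<phi> (- y)) x))\<^sup>2)" .
  let ?P = "LINT \<xi>|lborel. (cmod (theta_tilde (\<xi> / sqrt f - sqrt ?\<beta>)))\<^sup>2 * (cmod (fourier \<phi> \<xi>))\<^sup>2"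
    and ?Q = "LINT \<xi>|lborel. (cmod (theta_tilde (\<xi> / sqrt f - sqrt ?\<beta>)))\<^sup>2 * (cmod (fourier (\<lambda>y. \<phi> (- y)) \<xi>))\<^sup>2"
    and ?U = "LINT x|lborel. indicator {0<..} x * (cmod (\<phi> x))\<^sup>2"
    and ?V = "LINT x|lborel. indicator {0<..} x * (cmod (\<phi> (- x)))\<^sup>2"
  have PQ: "?P + ?Q = X"
  proof -
    have "?Q = (LINT \<xi>|lborel. (cmod (theta_tilde (- (\<xi> / sqrt f) - sqrt ?\<beta>)))\<^sup>2 * (cmod (fourier \<phi> \<xi>))\<^sup>2)"
      unfolding fourier_reflect by (subst lborel_integral_real_affine[of "-1" _ 0]) simp_all
    moreover have "integrable lborel (\<lambda>\<xi>. (cmod (theta_tilde (\<xi> / sqrt f - sqrt ?\<beta>)))\<^sup>2 * (cmod (fourier \<phi> \<xi>))\<^sup>2)"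
      "integrable lborel (\<lambda>\<xi>. (cmod (theta_tilde (- (\<xi> / sqrt f) - sqrt ?\<beta>)))\<^sup>2 * (cmod (fourier \<phi> \<xi>))\<^sup>2)"
      by (rule integrable_mult_fourier_sq[OF L2_fourier _ theta_tilde_bounded], measurable)+
    ultimately have "?P + ?Q = (LINT \<xi>|lborel. (cmod (theta_tilde (\<xi> / sqrt f - sqrt ?\<beta>)))\<^sup>2 * (cmod (fourier \<phi> \<xi>))\<^sup>2
        + (cmod (theta_tilde (- (\<xi> / sqrt f) - sqrt ?\<beta>)))\<^sup>2 * (cmod (fourier \<phi> \<xi>))\<^sup>2)"
      by simp
    also have "\<dots> = X"
      unfolding X_def
      by (intro Bochner_Integration.integral_cong)
         (simp_all add: p_leak_def e_beta_def norm_mult power_mult_distrib distrib_right)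
    finally show ?thesis .
  qed
  have UV: "?U + ?V \<le> N"
  proof -
    have "?V = (LINT x|lborel. indicator {..<0} x * (cmod (\<phi> x))\<^sup>2)"
      by (subst lborel_integral_real_affine[of "-1" _ 0]) (auto intro!: Bochner_Integration.integral_cong split: split_indicator)
    then have "?U + ?V = (LINT x|lborel. indicator {0<..} x * (cmod (\<phi> x))\<^sup>2 + indicator {..<0} x * (cmod (\<phi> x))\<^sup>2)"
      using ind[OF is_L2_D(3)[OF L2]] by simp
    also have "\<dots> \<le> N"
      unfolding N_def
      by (rule integral_mono) (auto intro!: ind is_L2_D(3)[OF L2] Bochner_Integration.integrable_add split: split_indicator)
    finally show ?thesis .
  qed
  have "sqrt Z \<le> sqrt X + sqrt ((C_sym ?\<beta>)\<^sup>2 * N)"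
  proof (rule sqrt_le_add_sqrt)
    show "0 \<le> X" "0 \<le> (C_sym ?\<beta>)\<^sup>2 * N" by (auto simp: X_def N_def)
    fix t :: real assume t: "t > 0"
    have "Z \<le> (1 + t) * (?P + ?Q) + (1 + 1 / t) * ((C_sym ?\<beta>)\<^sup>2 * (?U + ?V))"
      unfolding Z distrib_left using leakage_right[OF real t] l.leakage_right[OF real t] by linarith
    also have "\<dots> \<le> (1 + t) * X + (1 + 1 / t) * ((C_sym ?\<beta>)\<^sup>2 * N)"
      unfolding PQ using UV t by (intro add_left_mono mult_left_mono) auto
    finally show "Z \<le> (1 + t) * X + (1 + 1 / t) * ((C_sym ?\<beta>)\<^sup>2 * N)" .
  qed
  then show ?thesis
    unfolding L2norm_def Z_def X_def N_def using C_sym_nonneg[of ?\<beta>] by (simp add: real_sqrt_mult)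
qed

theorem theorem6p4:
  fixes ff :: real and \<phi> :: "real \<Rightarrow> real"
  assumes ff_pos: "ff > 0"
    and meas: "\<phi> \<in> borel_measurable lborel"
    and L2: "integrable lborel (\<lambda>x. (\<phi> x)\<^sup>2)"
    and supp: "AE x in lborel. x \<notin> {-1/2..1/2} \<longrightarrow> \<phi> x = 0"
  shows "L2norm (\<lambda>x. if x \<in> {-1/2..1/2} then 0 else fresnel_D ff (\<lambda>y. complex_of_real (\<phi> y)) x)
     \<le> L2norm (\<lambda>\<xi>. complex_of_real (p_leak ff (ff / 4) \<xi>) * fourier (\<lambda>y. complex_of_real (\<phi> y)) \<xi>)
        + C_sym (ff / 4) * L2norm (\<lambda>y. complex_of_real (\<phi> y))"
proof -
  define \<psi> where "\<psi> = (\<lambda>y. if y \<in> {-1/2..1/2} then complex_of_real (\<phi> y) else 0)"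
  have [measurable]: "\<phi> \<in> borel_measurable borel" using meas by simp
  have [measurable]: "\<psi> \<in> borel_measurable borel" unfolding \<psi>_def by measurable
  have AE: "AE y in lborel. complex_of_real (\<phi> y) = \<psi> y"
    using supp by eventually_elim (auto simp: \<psi>_def)
  have fourier: "fourier (\<lambda>y. complex_of_real (\<phi> y)) = fourier \<psi>"
  proof
    fix \<xi>
    have "(LINT x|lborel. cis (- \<xi> * x) * complex_of_real (\<phi> x)) = (LINT x|lborel. cis (- \<xi> * x) * \<psi> x)"
      by (rule integral_cong_AE) (use AE in \<open>auto elim: eventually_mono\<close>)
    then show "fourier (\<lambda>y. complex_of_real (\<phi> y)) \<xi> = fourier \<psi> \<xi>" by (simp add: fourier_def)
  qed
  then have D: "fresnel_D ff (\<lambda>y. complex_of_real (\<phi> y)) = fresnel_D ff \<psi>"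
    by (simp add: fresnel_D_def)
  have norm: "L2norm (\<lambda>y. complex_of_real (\<phi> y)) = L2norm \<psi>"
  proof -
    have "AE y in lborel. (cmod (complex_of_real (\<phi> y)))\<^sup>2 = (cmod (\<psi> y))\<^sup>2"
      using AE by eventually_elim (simp only:)
    then show ?thesis
      unfolding L2norm_def by (intro arg_cong[of _ _ sqrt] integral_cong_AE) measurable
  qed
  interpret fresnel_propagation ff \<psi>
  proof
    show "is_L2 \<psi>" by (rule is_L2_bound[OF _ L2]) (auto simp: \<psi>_def)
  qed (use ff_pos in \<open>auto simp: \<psi>_def\<close>)
  show ?thesis
    unfolding fourier D norm by (rule leakage) (simp add: \<psi>_def)
qed

end
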